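(* Let $\lambda$ be any cardinal. Then $$\mathbb{L}_c\mathrm{card}(\{\lambda\})=\mathrm{cov}(\lambda,\aleph_1,\aleph_1,2),$$ where $\mathbb{L}_c\mathrm{card}$ is the cofibrantly replaced left derived functor of the cardinality function (not functor) $\mathrm{card}:\mathrm{QtNaamen}\to On^\top$.
   Context: Work in ZFC with classes (for example, fix a transitive set model $V$ of ZFC and read "class" as "definable subset of $V$"). **The labelled category StNaamen.** Its objects are all classes of sets (including the empty class $\varnothing$, the initial object). There is at most one arrow between two objects, and $X\to Y$ iff for every $x\in X$ there is $y\in Y$ with $x\subseteq y$. An arrow $\mathcal A\to\mathcal B$ may carry labels as follows: - (wf) iff for every $A\in\mathcal A\cup\{\emptyset\}$, $B\in\mathcal B$ and $B'\subseteq B$ with $\mathrm{card}\,B'\le \mathrm{card}(A\cap B)+\aleph_0$ there is $A'\in\mathcal A\cup\{\emptyset\}$ with $B'\subseteq A'$. - (wc) iff every $B\in\mathcal B$ is contained, up to finitely many elements, in some $A\in\mathcal A\cup\{\emptyset\}$. - (c) iff for every set $B$ contained in some element of $\mathcal B$ there are $A\in\mathcal A\cup\{\emptyset\}$, $n\in\mathbb N$ and sets $B_0,\dots,B_n$, each contained in some element of $\mathcal B$, such that $\mathrm{card}(A\cap B_0)+\aleph_0=\mathrm{card}\,B_0+\aleph_0$, $\mathrm{card}(B_i\cap B_{i+1})+\aleph_0=\mathrm{card}\,B_{i+1}+\aleph_0$ for $0\le i<n$, and $B_n=B$. - (w) iff there is an object $Z$ with $\mathcal A\xrightarrow{(wc)}Z\xrightarrow{(wf)}\mathcal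 B$. **QtNaamen.** An object $X$ of StNaamen is *cute* if: whenever $A\subseteq B$ are sets with $\mathrm{card}\,A+\aleph_0=\mathrm{card}\,B+\aleph_0$, $W$ is an object of StNaamen with $W\xrightarrow{(wf)}\{B\}$, $W\to X$ and $\{A\}\to X$, then $\{B\}\to X$. QtNaamen is the full labelled subcategory of StNaamen consisting of cute objects. It is a model category in which (c) labels cofibrations and (w) labels weak equivalences. **Derived functor.** $On^\top$ is the ordered class of ordinals with an added top element $\top$. Put $\mathrm{card}(X)=$ the cardinality of $X$ if $X$ is a set, and $\mathrm{card}(X)=\top$ otherwise. For objects $X,Y$ of QtNaamen write $X\to_h Y$ if for some $n$ there is a finite zigzag in QtNaamen $$X\to X_1\xleftarrow{(w)}X_2\to X_3\xleftarrow{(w)}\cdots\to X_n\to Y$$ (equivalently, there is an arrow from $X$ to $Y$ in the homotopy category). An object $Y$ is cofibrant if $\varnothing\xrightarrow{(c)}Y$. Then $$\mathbb{L}_c\mathrm{card}(X)=\min\{\mathrm{card}(Y): X\to_h Y,\ \varnothing\xrightarrow{(c)}Y\},$$ with $Y$ ranging over objects of QtNaamen. **Covering numbers.** $\mathrm{cov}(\lambda,\kappa,\theta,\sigma)$ is the least size of a family $X\subseteq[\lambda]^{<\kappa}$ of subsets of $\lambda$ of cardinality less than $\kappa$ such that every subset of $\lambda$ of cardinality less than $\theta$ is contained in a union of fewer than $\sigma$ members of $X$.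
   Formalization: The formal theorem takes λ to be 0 or an infinite cardinal; for a nonzero finite λ = n the stated equation fails, since the left side is 0 (∅ is weakly equivalent to {n}) while cov(n,ℵ₁,ℵ₁,2) = 1. *)

theory Defs
  imports Main
begin

section \<open>Set theory with classes\<close>

text \<open>
  A universe of sets is an arbitrary relation \<open>mem\<close> on a type, and classes are members of a
  distinguished family \<open>Cls\<close> of subsets of the universe.  Taking for \<open>Cls\<close> the subsets that are
  definable with parameters in a (transitive) model of ZFC is one instance of the axioms below.
  All set-theoretic notions (finiteness, cardinality, natural numbers, ...) are interpreted
  inside the universe, which need not agree with the corresponding HOL notions.
\<close>

datatype fm =
    Mem nat nat
  | Equal nat nat
  | InClass nat nat
  | Neg fm
  | Conj fm fm
  | Exists nat fm

text \<open>
  Quantifiers range over sets only; \<open>c\<close> supplies the class parameters.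
\<close>

primrec sat :: "('v \<Rightarrow> 'v \<Rightarrow> bool) \<Rightarrow> (nat \<Rightarrow> 'v set) \<Rightarrow> (nat \<Rightarrow> 'v) \<Rightarrow> fm \<Rightarrow> bool" where
  "sat mem c e (Mem i j) = mem (e i) (e j)"
| "sat mem c e (Equal i j) = (e i = e j)"
| "sat mem c e (InClass i j) = (e i \<in> c j)"
| "sat mem c e (Neg p) = (\<not> sat mem c e p)"
| "sat mem c e (Conj p q) = (sat mem c e p \<and> sat mem c e q)"
| "sat mem c e (Exists i p) = (\<exists>x. sat mem c (e(i := x)) p)"

locale set_structure =
  fixes mem :: "'v \<Rightarrow> 'v \<Rightarrow> bool"
begin

definition elts :: "'v \<Rightarrow> 'v set" where
  "elts x = {y. mem y x}"

definition is_set :: "'v set \<Rightarrow> bool" where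
  "is_set A \<longleftrightarrow> (\<exists>x. elts x = A)"

text \<open>Only meaningful for \<open>A\<close> with \<open>is_set A\<close>.\<close>

definition set_of :: "'v set \<Rightarrow> 'v" where
  "set_of A = (THE x. elts x = A)"

definition vempty :: 'v where
  "vempty = set_of {}"

definition vinter :: "'v \<Rightarrow> 'v \<Rightarrow> 'v" where
  "vinter x y = set_of (elts x \<inter> elts y)"

definition vdiff :: "'v \<Rightarrow> 'v \<Rightarrow> 'v" where
  "vdiff x y = set_of (elts x - elts y)"

definition vsucc :: "'v \<Rightarrow> 'v" where
  "vsucc x = set_of (insert x (elts x))"

definition pair :: "'v \<Rightarrow> 'v \<Rightarrow> 'v" where
  "pair x y = set_of {set_of {x}, set_of {x, y}}"

definition is_fun_on :: "'v \<Rightarrow> 'v \<Rightarrow> bool" where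
  "is_fun_on f d \<longleftrightarrow>
     (\<forall>p\<in>elts f. \<exists>x\<in>elts d. \<exists>y. p = pair x y) \<and>
     (\<forall>x\<in>elts d. \<exists>!y. mem (pair x y) f)"

definition app :: "'v \<Rightarrow> 'v \<Rightarrow> 'v" where
  "app f x = (THE y. mem (pair x y) f)"

definition eqpoll :: "'v \<Rightarrow> 'v \<Rightarrow> bool" where
  "eqpoll x y \<longleftrightarrow> (\<exists>f. is_fun_on f x \<and> bij_betw (app f) (elts x) (elts y))"

subsection \<open>Ordinals and cardinals\<close>

text \<open>By Foundation, an ordinal is a transitive set of transitive sets.\<close>

definition transitive :: "'v \<Rightarrow> bool" where
  "transitive x \<longleftrightarrow> (\<forall>y\<in>elts x. elts y \<subseteq> elts x)"

definition ordinal :: "'v \<Rightarrow> bool" where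
  "ordinal x \<longleftrightarrow> transitive x \<and> (\<forall>y\<in>elts x. transitive y)"

definition ord_le :: "'v \<Rightarrow> 'v \<Rightarrow> bool" where
  "ord_le a b \<longleftrightarrow> mem a b \<or> a = b"

definition least_ord :: "('v \<Rightarrow> bool) \<Rightarrow> 'v" where
  "least_ord P = (THE a. ordinal a \<and> P a \<and> (\<forall>b. ordinal b \<and> P b \<longrightarrow> ord_le a b))"

definition vcard :: "'v \<Rightarrow> 'v" where
  "vcard x = least_ord (\<lambda>a. eqpoll a x)"

definition cardinal :: "'v \<Rightarrow> bool" where
  "cardinal k \<longleftrightarrow> ordinal k \<and> (\<forall>a\<in>elts k. \<not> eqpoll a k)"

definition omega :: 'v where
  "omega = set_of {n. \<forall>i. mem vempty i \<and> (\<forall>m\<in>elts i. mem (vsucc m) i) \<longrightarrow> mem n i}"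

definition aleph1 :: 'v where
  "aleph1 = least_ord (\<lambda>a. cardinal a \<and> mem omega a)"

definition vtwo :: 'v where
  "vtwo = vsucc (vsucc vempty)"

definition vfinite :: "'v \<Rightarrow> bool" where
  "vfinite x \<longleftrightarrow> (\<exists>n\<in>elts omega. eqpoll n x)"

definition disj_sum :: "'v \<Rightarrow> 'v \<Rightarrow> 'v" where
  "disj_sum x y =
     set_of (pair vempty ` elts x \<union> pair (vsucc vempty) ` elts y)"

definition card_add :: "'v \<Rightarrow> 'v \<Rightarrow> 'v" where
  "card_add k m = vcard (disj_sum k m)"

text \<open>The quantity \<open>card x + \<aleph>\<^sub>0\<close>.\<close>

definition card_aleph0 :: "'v \<Rightarrow> 'v" where
  "card_aleph0 x = card_add (vcard x) omega"

definition is_cover ::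
    "'v \<Rightarrow> 'v \<Rightarrow> 'v \<Rightarrow> 'v \<Rightarrow> 'v \<Rightarrow> bool" where
  "is_cover l k t s X \<longleftrightarrow>
     (\<forall>x\<in>elts X. elts x \<subseteq> elts l \<and> mem (vcard x) k) \<and>
     (\<forall>y. elts y \<subseteq> elts l \<and> mem (vcard y) t \<longrightarrow>
        (\<exists>F. elts F \<subseteq> elts X \<and> mem (vcard F) s \<and> elts y \<subseteq> (\<Union>x\<in>elts F. elts x)))"

definition cov :: "'v \<Rightarrow> 'v \<Rightarrow> 'v \<Rightarrow> 'v \<Rightarrow> 'v" where
  "cov l k t s = least_ord (\<lambda>a. \<exists>X. is_cover l k t s X \<and> a = vcard X)"

end

subsection \<open>The axioms\<close>

locale class_structure = set_structure mem
  for mem :: "'v \<Rightarrow> 'v \<Rightarrow> bool" +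
  fixes Cls :: "'v set set"

text \<open>
  Replacement for classes yields the separation scheme; applied to the classes provided by
  comprehension, these are the schemes of ZFC with class parameters.  Comprehension makes every
  set a class.
\<close>

locale zfc_classes = class_structure mem Cls
  for mem :: "'v \<Rightarrow> 'v \<Rightarrow> bool" and Cls :: "'v set set" +
  assumes classes: "Cls \<noteq> {}"
    and extensionality: "elts x = elts y \<Longrightarrow> x = y"
    and foundation: "elts x \<noteq> {} \<Longrightarrow> \<exists>y\<in>elts x. elts y \<inter> elts x = {}"
    and pairing: "\<exists>z. elts z = {x, y}"
    and union: "\<exists>z. elts z = (\<Union>y\<in>elts x. elts y)"
    and power_set: "\<exists>z. elts z = {y. elts y \<subseteq> elts x}"
    and infinity: "\<exists>x. (\<exists>y\<in>elts x. elts y = {}) \<and>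
          (\<forall>y\<in>elts x. \<exists>z\<in>elts x. elts z = insert y (elts y))"
    and choice: "(\<forall>y\<in>elts x. elts y \<noteq> {}) \<Longrightarrow>
          (\<forall>y\<in>elts x. \<forall>z\<in>elts x. y \<noteq> z \<longrightarrow> elts y \<inter> elts z = {}) \<Longrightarrow>
          \<exists>t. \<forall>y\<in>elts x. \<exists>!u. u \<in> elts t \<inter> elts y"
    and comprehension: "range c \<subseteq> Cls \<Longrightarrow> {x. sat mem c (e(i := x)) p} \<in> Cls"
    and replacement: "R \<in> Cls \<Longrightarrow>
          (\<forall>x y z. pair x y \<in> R \<and> pair x z \<in> R \<longrightarrow> y = z) \<Longrightarrow>
          \<exists>b. elts b = {y. \<exists>x\<in>elts a. pair x y \<in> R}"

section \<open>The labelled category StNaamen\<close>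

text \<open>
  Objects are the members of \<open>Cls\<close>.  A label is carried by an arrow, so each labelled relation
  includes the existence of the arrow.
\<close>

context set_structure
begin

definition arrow :: "'v set \<Rightarrow> 'v set \<Rightarrow> bool" where
  "arrow X Y \<longleftrightarrow> (\<forall>x\<in>X. \<exists>y\<in>Y. elts x \<subseteq> elts y)"

definition arrow_wf :: "'v set \<Rightarrow> 'v set \<Rightarrow> bool" where
  "arrow_wf \<A> \<B> \<longleftrightarrow> arrow \<A> \<B> \<and>
     (\<forall>A\<in>\<A> \<union> {vempty}. \<forall>B\<in>\<B>. \<forall>B'.
        elts B' \<subseteq> elts B \<and> ord_le (vcard B') (card_aleph0 (vinter A B)) \<longrightarrow>
        (\<exists>A'\<in>\<A> \<union> {vempty}. elts B' \<subseteq> elts A'))"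

definition arrow_wc :: "'v set \<Rightarrow> 'v set \<Rightarrow> bool" where
  "arrow_wc \<A> \<B> \<longleftrightarrow> arrow \<A> \<B> \<and>
     (\<forall>B\<in>\<B>. \<exists>A\<in>\<A> \<union> {vempty}. vfinite (vdiff B A))"

text \<open>
  The sequence \<open>B\<^sub>0, \<dots>, B\<^sub>n\<close> is a set-theoretic function \<open>s\<close> with domain \<open>n + 1\<close>.
\<close>

definition arrow_c :: "'v set \<Rightarrow> 'v set \<Rightarrow> bool" where
  "arrow_c \<A> \<B> \<longleftrightarrow> arrow \<A> \<B> \<and>
     (\<forall>B. (\<exists>b\<in>\<B>. elts B \<subseteq> elts b) \<longrightarrow>
        (\<exists>A\<in>\<A> \<union> {vempty}. \<exists>n\<in>elts omega. \<exists>s.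
           is_fun_on s (vsucc n) \<and>
           (\<forall>i\<in>elts (vsucc n). \<exists>b\<in>\<B>. elts (app s i) \<subseteq> elts b) \<and>
           card_aleph0 (vinter A (app s vempty)) = card_aleph0 (app s vempty) \<and>
           (\<forall>i\<in>elts n.
              card_aleph0 (vinter (app s i) (app s (vsucc i))) =
              card_aleph0 (app s (vsucc i))) \<and>
           app s n = B))"

end

context class_structure
begin

definition arrow_w :: "'v set \<Rightarrow> 'v set \<Rightarrow> bool" where
  "arrow_w \<A> \<B> \<longleftrightarrow> (\<exists>Z\<in>Cls. arrow_wc \<A> Z \<and> arrow_wf Z \<B>)"

section \<open>The category QtNaamen\<close>

definition cute :: "'v set \<Rightarrow> bool" where
  "cute X \<longleftrightarrow>
     (\<forall>A B. \<forall>W\<in>Cls.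
        elts A \<subseteq> elts B \<and> card_aleph0 A = card_aleph0 B \<and>
        arrow_wf W {B} \<and> arrow W X \<and> arrow {A} X \<longrightarrow> arrow {B} X)"

definition QtNaamen :: "'v set set" where
  "QtNaamen = {X \<in> Cls. cute X}"

text \<open>Finite zigzags \<open>X \<rightarrow> X\<^sub>1 \<leftarrow> X\<^sub>2 \<rightarrow> \<dots> \<rightarrow> X\<^sub>n \<rightarrow> Y\<close>, all backward arrows being weak equivalences.\<close>

inductive arrow_h :: "'v set \<Rightarrow> 'v set \<Rightarrow> bool" where
  last: "X \<in> QtNaamen \<Longrightarrow> X1 \<in> QtNaamen \<Longrightarrow> Y \<in> QtNaamen \<Longrightarrow>
    arrow X X1 \<Longrightarrow> arrow X1 Y \<Longrightarrow> arrow_h X Y"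
| step: "X \<in> QtNaamen \<Longrightarrow> X1 \<in> QtNaamen \<Longrightarrow> X2 \<in> QtNaamen \<Longrightarrow>
    arrow X X1 \<Longrightarrow> arrow_w X2 X1 \<Longrightarrow> arrow_h X2 Y \<Longrightarrow> arrow_h X Y"

end

section \<open>The derived functor of cardinality\<close>

text \<open>\<open>On\<^sup>\<top>\<close>; \<open>Ord\<close> is applied to ordinals only.\<close>

datatype 'v on_top = Ord 'v | Top

context class_structure
begin

fun on_top_le :: "'v on_top \<Rightarrow> 'v on_top \<Rightarrow> bool" where
  "on_top_le _ Top \<longleftrightarrow> True"
| "on_top_le Top (Ord b) \<longleftrightarrow> False"
| "on_top_le (Ord a) (Ord b) \<longleftrightarrow> ord_le a b"

definition on_top_min :: "'v on_top set \<Rightarrow> 'v on_top" where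
  "on_top_min S = (THE m. m \<in> S \<and> (\<forall>a\<in>S. on_top_le m a))"

definition class_card :: "'v set \<Rightarrow> 'v on_top" where
  "class_card X = (if is_set X then Ord (vcard (set_of X)) else Top)"

definition cofibrant :: "'v set \<Rightarrow> bool" where
  "cofibrant Y \<longleftrightarrow> arrow_c {} Y"

definition Lc_card :: "'v set \<Rightarrow> 'v on_top" where
  "Lc_card X = on_top_min {class_card Y | Y. Y \<in> QtNaamen \<and> arrow_h X Y \<and> cofibrant Y}"

end

end

theory Submission
  imports Defs
begin

text \<open>
  An object is cofibrant iff all its elements are countable, and a family \<open>Y\<close> of countable subsets
  of \<open>\<lambda>\<close> covering every countable subset satisfies \<open>Y \<rightarrow> {\<lambda>}\<close> with label (wf); hence
  the derived cardinality is at most the covering number.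

  Conversely, along any zigzag starting at \<open>{\<lambda>}\<close> every countable subset of \<open>\<lambda>\<close> stays contained, up to
  finitely many elements, in an element of the current object.  To get rid of the finite error
  without cardinal arithmetic, embed \<open>\<lambda> \<times> \<omega>\<close> into \<open>\<lambda>\<close> and apply this to the image of \<open>b \<times> \<omega>\<close> for
  a countable \<open>b\<close>: an element \<open>y\<close> containing almost all of it meets the fibre over each point of \<open>b\<close>,
  so that \<open>b\<close> is contained in the projection of \<open>y\<close> to \<open>\<lambda>\<close>.  Projecting a cofibrant \<open>Y\<close> in this
  way gives a covering family with at most as many members as \<open>Y\<close>.
\<close>

section \<open>Definability\<close>

text \<open>\<open>mem\<close> is an arbitrary relation, so HOL's own sets, naturals and cardinals
  say nothing about the internal ones, and replacement and comprehension reach only what formulas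
  define. Hence the ordinals, cardinals and recursion needed are rebuilt inside the universe, and
  every internal induction or construction of a function carries a definability condition. A finite
  error cannot simply be repaired by adjoining finite sets to the members of \<open>Y\<close>: an
  infinite lambda has at least lambda many finite subsets, and the enlarged family could a priori
  outgrow \<open>Y\<close>. Projecting fibres repairs it without adding a single member. The
  embedding of lambda x omega comes from writing each ordinal below lambda as a limit (or zero) plus
  a natural number, which reduces it to omega x omega. Countability is the right threshold because
  (wf), with the empty set in the role of A, captures every countable subset of an element of the
  target.\<close>

primrec var_bound :: "fm \<Rightarrow> nat" where
  "var_bound (Mem i j) = Suc (max i j)"
| "var_bound (Equal i j) = Suc (max i j)"
| "var_bound (InClass i j) = Suc i"
| "var_bound (Neg p) = var_bound p"
| "var_bound (Conj p q) = max (var_bound p) (var_bound q)"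
| "var_bound (Exists i p) = max (Suc i) (var_bound p)"

primrec rename :: "(nat \<Rightarrow> nat) \<Rightarrow> (nat \<Rightarrow> nat) \<Rightarrow> fm \<Rightarrow> fm" where
  "rename f g (Mem i j) = Mem (f i) (f j)"
| "rename f g (Equal i j) = Equal (f i) (f j)"
| "rename f g (InClass i j) = InClass (f i) (g j)"
| "rename f g (Neg p) = Neg (rename f g p)"
| "rename f g (Conj p q) = Conj (rename f g p) (rename f g q)"
| "rename f g (Exists i p) = Exists (f i) (rename f g p)"

text \<open>Injectivity of \<open>f\<close> below the bound prevents capture: updating
  \<open>f i\<close> in the \<open>Exists\<close> case must not disturb the images of the other
  variables. Class indices are never bound, so \<open>g\<close> may be arbitrary.\<close>

lemma sat_rename:
  assumes "inj_on f {..<N}" "var_bound p \<le> N" "\<And>n. n < N \<Longrightarrow> e' n = e (f n)"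
  shows "sat mem c e (rename f g p) = sat mem (c \<circ> g) e' p"
  using assms(2,3)
proof (induction p arbitrary: e e')
  case (Exists i p)
  have "sat mem c (e(f i := x)) (rename f g p) = sat mem (c \<circ> g) (e'(i := x)) p" for x
    using Exists.prems assms(1) by (intro Exists.IH) (auto simp: inj_on_def)
  then show ?case by (simp add: comp_def)
next
  case (Neg p)
  from Neg.IH[of e' e] Neg.prems show ?case by simp
next
  case (Conj p q)
  from Conj.IH(1)[of e' e] Conj.IH(2)[of e' e] Conj.prems show ?case by simp
qed (auto simp: less_Suc_eq_le)

lemma sat_rename_classes:
  "sat mem c e (rename id g p) = sat mem (c \<circ> g) e p"
  by (rule sat_rename[where N = "var_bound p"]) auto

context zfc_classes
begin

text \<open>
  Environments are read as de Bruijn stacks: index \<open>0\<close> is the innermost bound variable, so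
  that moving under a quantifier replaces \<open>e\<close> by \<open>\<lambda>n. e (Suc n)\<close>.
\<close>

definition dfp :: "((nat \<Rightarrow> 'v) \<Rightarrow> bool) \<Rightarrow> bool" where
  "dfp P \<longleftrightarrow> (\<exists>p c. range c \<subseteq> Cls \<and> (\<forall>e. P e = sat mem c e p))"

text \<open>Formulas have no function symbols, so a term counts as definable when its graph does;
  the value sits at index 0 and the arguments move up by one.\<close>

definition dft :: "((nat \<Rightarrow> 'v) \<Rightarrow> 'v) \<Rightarrow> bool" where
  "dft t \<longleftrightarrow> dfp (\<lambda>e. e 0 = t (\<lambda>n. e (Suc n)))"

text \<open>Closure rules: \<open>intro df\<close> proves a definability claim by following the
  syntax of the predicate.\<close>

named_theorems df

lemma dfpI: "range c \<subseteq> Cls \<Longrightarrow> (\<And>e. P e = sat mem c e p) \<Longrightarrow> dfp P"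
  unfolding dfp_def by blast

lemma obtain_params: obtains c :: "nat \<Rightarrow> 'v set" where "range c \<subseteq> Cls"
proof -
  obtain C where "C \<in> Cls" using classes by blast
  then have "range (\<lambda>_::nat. C) \<subseteq> Cls" by auto
  then show ?thesis using that by blast
qed

lemma dfp_mem_var: "dfp (\<lambda>e. mem (e i) (e j))"
  by (rule obtain_params, rule dfpI[where p = "Mem i j"]) auto

lemma dfp_eq_var: "dfp (\<lambda>e. e i = e j)"
  by (rule obtain_params, rule dfpI[where p = "Equal i j"]) auto

lemma dfp_class_var: "C \<in> Cls \<Longrightarrow> dfp (\<lambda>e. e i \<in> C)"
  by (rule dfpI[where p = "InClass i 0" and c = "\<lambda>_. C"]) auto

lemma dfp_not: "dfp P \<Longrightarrow> dfp (\<lambda>e. \<not> P e)"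
  unfolding dfp_def by (metis sat.simps(4))

lemma dfp_conj:
  assumes "dfp P" "dfp Q"
  shows "dfp (\<lambda>e. P e \<and> Q e)"
proof -
  from assms obtain p q c d where c: "range c \<subseteq> Cls" "\<And>e. P e = sat mem c e p"
    and d: "range d \<subseteq> Cls" "\<And>e. Q e = sat mem d e q" unfolding dfp_def by metis
  \<comment> \<open>The two parameter sequences are merged into one: those of \<open>p\<close> at
    even indices, those of \<open>q\<close> at odd ones.\<close>
  define b where "b = (\<lambda>n::nat. if even n then c (n div 2) else d (n div 2))"
  have b: "b \<circ> (\<lambda>n. 2 * n) = c" "b \<circ> (\<lambda>n. Suc (2 * n)) = d" by (auto simp: b_def)
  show ?thesis
  proof (rule dfpI)
    show "range b \<subseteq> Cls" using c d by (auto simp: b_def)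
    show "(P e \<and> Q e) = sat mem b e
        (Conj (rename id (\<lambda>n. 2 * n) p) (rename id (\<lambda>n. Suc (2 * n)) q))" for e
      using c d b by (simp add: sat_rename_classes)
  qed
qed

lemma dfp_imp: "dfp P \<Longrightarrow> dfp Q \<Longrightarrow> dfp (\<lambda>e. P e \<longrightarrow> Q e)"
  using dfp_not[OF dfp_conj[of P "\<lambda>e. \<not> Q e"]] dfp_not by simp

lemma dfp_disj: "dfp P \<Longrightarrow> dfp Q \<Longrightarrow> dfp (\<lambda>e. P e \<or> Q e)"
  using dfp_imp[of "\<lambda>e. \<not> P e" Q] dfp_not by (simp add: disj_imp)

lemma dfp_iff: "dfp P \<Longrightarrow> dfp Q \<Longrightarrow> dfp (\<lambda>e. P e = Q e)"
  using dfp_conj[of "\<lambda>e. P e \<longrightarrow> Q e" "\<lambda>e. Q e \<longrightarrow> P e"] dfp_imp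
  by (simp add: iff_conv_conj_imp)

lemma dfp_ex:
  assumes "dfp (\<lambda>e. P (e 0) (\<lambda>n. e (Suc n)))"
  shows "dfp (\<lambda>e. \<exists>x. P x e)"
proof -
  from assms obtain p c where c: "range c \<subseteq> Cls"
    and p: "\<And>e. P (e 0) (\<lambda>n. e (Suc n)) = sat mem c e p" unfolding dfp_def by metis
  \<comment> \<open>Formulas bind named variables, predicates read stacks. \<open>K\<close> lies
    beyond every variable of \<open>p\<close>, so index 0 can be renamed to \<open>K\<close> and all
    others lowered by one without a clash.\<close>
  define K where "K = var_bound p"
  define f where "f = (\<lambda>n. case n of 0 \<Rightarrow> K | Suc m \<Rightarrow> m)"
  show ?thesis
  proof (rule dfpI[OF c])
    fix e
    have "sat mem c (e(K := x)) (rename f id p) = P x e" for x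
    proof -
      have "sat mem c (e(K := x)) (rename f id p) = sat mem (c \<circ> id) (case_nat x e) p"
      proof (rule sat_rename[where N = K])
        show "inj_on f {..<K}" by (auto simp: inj_on_def f_def split: nat.splits)
        show "case_nat x e n = (e(K := x)) (f n)" if "n < K" for n
          using that by (auto simp: f_def split: nat.splits)
      qed (simp add: K_def)
      then show ?thesis using p[of "case_nat x e"] by simp
    qed
    then show "(\<exists>x. P x e) = sat mem c e (Exists K (rename f id p))" by simp
  qed
qed

lemma dfp_all: "dfp (\<lambda>e. P (e 0) (\<lambda>n. e (Suc n))) \<Longrightarrow> dfp (\<lambda>e. \<forall>x. P x e)"
  using dfp_not[OF dfp_ex[of "\<lambda>x e. \<not> P x e"]] dfp_not by simp

lemma dfp_rename:
  assumes "dfp P" "inj f"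
  shows "dfp (\<lambda>e. P (\<lambda>n. e (f n)))"
proof -
  from assms obtain p c where c: "range c \<subseteq> Cls"
    and p: "\<And>e. P e = sat mem c e p" unfolding dfp_def by metis
  show ?thesis
    using sat_rename[of f "var_bound p" p "\<lambda>n. e (f n)" e mem c id for e] p inj_on_subset[OF assms(2)]
    by (intro dfpI[OF c, where p = "rename f id p"]) simp
qed

section \<open>Definable terms and their substitution\<close>

lemma dft_shift:
  assumes "dft t" shows "dft (\<lambda>e. t (\<lambda>n. e (Suc n)))"
  using dfp_rename[OF assms[unfolded dft_def], where f = "case_nat 0 (\<lambda>n. Suc (Suc n))"]
  by (simp add: dft_def inj_def split: nat.splits)

lemma dfp_subst: "dft t \<Longrightarrow> dfp (\<lambda>e. P (e 0) (\<lambda>n. e (Suc n))) \<Longrightarrow> dfp (\<lambda>e. P (t e) e)"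
  using dfp_ex[of "\<lambda>x e. x = t e \<and> P x e"] dfp_conj unfolding dft_def by simp

lemma dfp_subst1:
  assumes "dfp (\<lambda>e. P (e 0))" "dft t"
  shows "dfp (\<lambda>e. P (t e))"
  using assms dfp_subst[of t "\<lambda>x e. P x"] by simp

text \<open>This and its variants lift definability of a relation between variables to arbitrary
  definable terms; most definability lemmas for the set-theoretic notions below are obtained in this
  way.\<close>

lemma dfp_subst2:
  assumes "dfp (\<lambda>e. P (e 0) (e (Suc 0)))" "dft s" "dft t"
  shows "dfp (\<lambda>e. P (s e) (t e))"
proof (rule dfp_subst[OF assms(2)], rule dfp_subst[OF dft_shift[OF assms(3)]])
  show "dfp (\<lambda>e. P (e (Suc 0)) (e 0))"
    \<comment> \<open>The term substituted last lies on top of the stack, so indices 0 and 1 are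
      swapped.\<close>
    using dfp_rename[OF assms(1), where f = "\<lambda>n. case n of 0 \<Rightarrow> Suc 0 | Suc m \<Rightarrow> case m of 0 \<Rightarrow> 0 | Suc k \<Rightarrow> n"]
    by (simp add: inj_def split: nat.splits)
qed

lemma dfp_subst3:
  assumes "dfp (\<lambda>e. P (e 0) (e (Suc 0)) (e (Suc (Suc 0))))" "dft s" "dft t" "dft u"
  shows "dfp (\<lambda>e. P (s e) (t e) (u e))"
proof (rule dfp_subst[OF assms(2)], rule dfp_subst[OF dft_shift[OF assms(3)]],
    rule dfp_subst[OF dft_shift[OF dft_shift[OF assms(4)]]])
  show "dfp (\<lambda>e. P (e (Suc (Suc 0))) (e (Suc 0)) (e 0))"
    using dfp_rename[OF assms(1), where f = "\<lambda>n. if n = 0 then Suc (Suc 0) else if n = Suc (Suc 0) then 0 else n"]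
    by (simp add: inj_def)
qed

lemma dft_var: "dft (\<lambda>e. e i)"
  unfolding dft_def by (rule dfp_eq_var)

lemma dft_subst1:
  assumes "dft (\<lambda>e. F (e 0))" "dft t"
  shows "dft (\<lambda>e. F (t e))"
  unfolding dft_def
proof (rule dfp_subst2[of "\<lambda>x y. x = F y"])
  show "dfp (\<lambda>e. e 0 = F (e (Suc 0)))" using assms(1) by (simp add: dft_def)
qed (use dft_var dft_shift[OF assms(2)] in auto)

lemma dft_subst2:
  assumes "dft (\<lambda>e. F (e 0) (e (Suc 0)))" "dft s" "dft t"
  shows "dft (\<lambda>e. F (s e) (t e))"
  unfolding dft_def
proof (rule dfp_subst3[of "\<lambda>x y z. x = F y z"])
  show "dfp (\<lambda>e. e 0 = F (e (Suc 0)) (e (Suc (Suc 0))))" using assms(1) by (simp add: dft_def)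
qed (use dft_var dft_shift[OF assms(2)] dft_shift[OF assms(3)] in auto)

lemma dft_if:
  assumes "dfp P" "dft s" "dft t"
  shows "dft (\<lambda>e. if P e then s e else t e)"
proof -
  have "dfp (\<lambda>e. P (\<lambda>n. e (Suc n)))" using dfp_rename[OF assms(1), of Suc] by simp
  then have "dfp (\<lambda>e. (P (\<lambda>n. e (Suc n)) \<longrightarrow> e 0 = s (\<lambda>n. e (Suc n))) \<and>
      (\<not> P (\<lambda>n. e (Suc n)) \<longrightarrow> e 0 = t (\<lambda>n. e (Suc n))))"
    using assms(2,3) unfolding dft_def by (intro dfp_conj dfp_imp dfp_not)
  then show ?thesis unfolding dft_def
    by (rule back_subst[where P = dfp]) auto
qed

lemma dfp_Collect: "dfp (\<lambda>e. P (e 0)) \<Longrightarrow> {x. P x} \<in> Cls"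
proof -
  assume "dfp (\<lambda>e. P (e 0))"
  then obtain p c where c: "range c \<subseteq> Cls" and p: "\<And>e. P (e 0) = sat mem c e p"
    unfolding dfp_def by metis
  from comprehension[OF c, of undefined 0 p] p[of "undefined(0 := x)" for x] show ?thesis by simp
qed

lemma elts_in_Cls: "elts a \<in> Cls"
proof -
  obtain c :: "nat \<Rightarrow> 'v set" where "range c \<subseteq> Cls" using obtain_params by blast
  from comprehension[OF this, of "\<lambda>_. a" 0 "Mem 0 (Suc 0)"] show ?thesis by (simp add: elts_def)
qed



text \<open>A set becomes a parameter of a formula through the class \<open>{a}\<close>.\<close>

lemma dft_const: "dft (\<lambda>e. a)"
proof -
  obtain z where z: "elts z = {a, a}" using pairing by blast
  from dfp_class_var[OF elts_in_Cls[of z], of 0] z show ?thesis by (simp add: dft_def)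
qed

lemma dfp_const: "dfp (\<lambda>e. Q)"
proof (cases Q)
  case True then show ?thesis using dfp_eq_var[of 0 0] by simp
next
  case False then show ?thesis using dfp_not[OF dfp_eq_var[of 0 0]] by simp
qed

lemmas dfp_mem = dfp_subst2[of mem, OF dfp_mem_var]
lemmas dfp_eq = dfp_subst2[of "(=)", OF dfp_eq_var]


lemma dfp_elts: "dft s \<Longrightarrow> dft t \<Longrightarrow> dfp (\<lambda>e. s e \<in> elts (t e))"
  unfolding elts_def mem_Collect_eq by (rule dfp_mem)



lemma dfp_ball:
  assumes "dft t" "dfp (\<lambda>e. P (e 0) (\<lambda>n. e (Suc n)))"
  shows "dfp (\<lambda>e. \<forall>x\<in>elts (t e). P x e)"
  unfolding Ball_def by (intro dfp_all dfp_imp dfp_elts dft_shift dft_var assms)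

lemma dfp_bex:
  assumes "dft t" "dfp (\<lambda>e. P (e 0) (\<lambda>n. e (Suc n)))"
  shows "dfp (\<lambda>e. \<exists>x\<in>elts (t e). P x e)"
  unfolding Bex_def by (intro dfp_ex dfp_conj dfp_elts dft_shift dft_var assms)

lemma dfp_ex1:
  assumes "dfp (\<lambda>e. P (e 0) (\<lambda>n. e (Suc n)))"
  shows "dfp (\<lambda>e. \<exists>!x. P x e)"
proof -
  have "dfp (\<lambda>e. P (e 0) (\<lambda>n. e (Suc (Suc n))))"
    using dfp_rename[OF assms, where f = "case_nat 0 (\<lambda>n. Suc (Suc n))"]
    by (simp add: inj_def split: nat.splits)
  then show ?thesis unfolding Ex1_def
    by (intro dfp_ex dfp_conj dfp_all dfp_imp dfp_eq dft_var assms)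
qed

lemmas [df] = dfp_const dfp_mem dfp_eq dfp_elts dfp_not dfp_conj dfp_disj dfp_imp dfp_iff
  dfp_ball dfp_bex dfp_ex dfp_all dfp_ex1 dft_const dft_var dft_if

lemma dfp_subset [df]: "dft s \<Longrightarrow> dft t \<Longrightarrow> dfp (\<lambda>e. elts (s e) \<subseteq> elts (t e))"
  unfolding subset_eq by (rule dfp_subst2[of "\<lambda>x y. \<forall>z\<in>elts x. z \<in> elts y"]) (intro df)+

text \<open>\<open>THE\<close> is not definable, its value on non-unique predicates being arbitrary.\<close>

definition vthe :: "('v \<Rightarrow> bool) \<Rightarrow> 'v" where
  "vthe P = (if \<exists>!y. P y then THE y. P y else vempty)"

lemma vthe_eq: "P y \<Longrightarrow> (\<And>z. P z \<Longrightarrow> z = y) \<Longrightarrow> vthe P = y"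
  unfolding vthe_def by (metis the_equality)

lemma dft_vthe [df]:
  assumes "dfp (\<lambda>e. P (e 0) (\<lambda>n. e (Suc n)))"
  shows "dft (\<lambda>e. vthe (\<lambda>y. P y e))"
proof -
  have "(y = vthe (\<lambda>y. P y e)) =
      (((\<exists>!y. P y e) \<longrightarrow> P y e) \<and> (\<not> (\<exists>!y. P y e) \<longrightarrow> y = vempty))" for y e
    unfolding vthe_def using theI'[of "\<lambda>y. P y e"] the1_equality[of "\<lambda>y. P y e" y]
    by (cases "\<exists>!y. P y e") (simp_all, metis)
  moreover have "dfp (\<lambda>e. P (e 0) (\<lambda>n. e (Suc (Suc n))))"
    using dfp_rename[OF assms, where f = "case_nat 0 (\<lambda>n. Suc (Suc n))"]
    by (simp add: inj_def split: nat.splits)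
  ultimately show ?thesis unfolding dft_def
    by (simp only:) (intro df assms)
qed

lemma set_of_elts [simp]: "set_of (elts x) = x"
  unfolding set_of_def by (rule the_equality, rule refl, rule extensionality)

lemma elts_set_of: "is_set A \<Longrightarrow> elts (set_of A) = A"
  unfolding is_set_def using set_of_elts by metis

lemma elts_inject: "elts x = elts y \<longleftrightarrow> x = y"
  by (metis extensionality)

lemma mem_elts: "mem x y \<longleftrightarrow> x \<in> elts y" by (simp add: elts_def)

lemma dft_set_of:
  assumes "\<And>e. is_set {y. P y e}" "dfp (\<lambda>e. P (e 0) (\<lambda>n. e (Suc n)))"
  shows "dft (\<lambda>e. set_of {y. P y e})"
proof -
  have "z = set_of {y. P y e} \<longleftrightarrow> (\<forall>y. y \<in> elts z \<longleftrightarrow> P y e)" for z e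
    using assms(1)[of e] elts_set_of set_of_elts by (metis Collect_cong Collect_mem_eq mem_Collect_eq)
  moreover have "dfp (\<lambda>e. P (e 0) (\<lambda>n. e (Suc (Suc n))))"
    using dfp_rename[OF assms(2), where f = "case_nat 0 (\<lambda>n. Suc (Suc n))"]
    by (simp add: inj_def split: nat.splits)
  ultimately show ?thesis unfolding dft_def by (simp only:) (intro df assms)
qed

section \<open>Basic set operations\<close>

definition upair :: "'v \<Rightarrow> 'v \<Rightarrow> 'v" where
  "upair x y = set_of {x, y}"

lemma is_set_elts [simp]: "is_set (elts x)" unfolding is_set_def by blast

lemma is_set_upair [simp]: "is_set {x, y}" unfolding is_set_def by (rule pairing)

lemma is_set_singleton [simp]: "is_set {x}" using is_set_upair[of x x] by simp

lemma dft_upair: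
  assumes "dft s" "dft t"
  shows "dft (\<lambda>e. upair (s e) (t e))"
proof -
  have *: "{z. z = x \<or> z = y} = {x, y}" for x y :: 'v by auto
  have "dft (\<lambda>e. set_of {y. y = e 0 \<or> y = e (Suc 0)})"
    by (rule dft_set_of, simp add: *) (intro df)
  from dft_subst2[of "\<lambda>x y. set_of {z. z = x \<or> z = y}", OF this assms] show ?thesis
    by (simp add: * upair_def)
qed

lemma elts_upair [simp]: "elts (upair x y) = {x, y}"
  by (simp add: upair_def elts_set_of)

lemma upair_eq: "upair x y = upair x' y' \<longleftrightarrow> x = x' \<and> y = y' \<or> x = y' \<and> y = x'"
proof -
  have "upair x y = upair x' y' \<longleftrightarrow> {x, y} = {x', y'}" by (metis elts_upair upair_def)
  then show ?thesis by (simp only: doubleton_eq_iff)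
qed

lemma pair_alt: "pair x y = upair (upair x x) (upair x y)" by (simp add: pair_def upair_def)

lemma dft_pair [df]: "dft s \<Longrightarrow> dft t \<Longrightarrow> dft (\<lambda>e. pair (s e) (t e))"
  unfolding pair_alt by (intro dft_upair)

lemma pair_inject [simp]: "pair x y = pair x' y' \<longleftrightarrow> x = x' \<and> y = y'"
  unfolding pair_alt upair_eq by metis

text \<open>Separation is replacement for the identity restricted to \<open>P\<close>, a
  single-valued class.\<close>

lemma is_set_sep:
  assumes "dfp (\<lambda>e. P (e 0))" "A \<subseteq> elts a" "\<And>x. x \<in> A \<longleftrightarrow> x \<in> elts a \<and> P x"
  shows "is_set A"
proof -
  have "{p. \<exists>x. P x \<and> p = pair x x} \<in> Cls"
    by (rule dfp_Collect) (intro df dfp_subst1[OF assms(1)])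
  from replacement[OF this, of a] obtain b
    where "elts b = {y. \<exists>x\<in>elts a. pair x y \<in> {p. \<exists>x. P x \<and> p = pair x x}}" by auto
  then have "elts b = A" using assms(2,3) by auto
  then show ?thesis by (auto simp: is_set_def)
qed

lemma is_set_Collect: "dfp (\<lambda>e. P (e 0)) \<Longrightarrow> is_set {x \<in> elts a. P x}"
  by (rule is_set_sep[of P]) auto



lemma is_set_empty [simp]: "is_set {}"
  by (rule is_set_sep[of "\<lambda>x. False"]) (auto intro!: df)

lemma elts_vempty [simp]: "elts vempty = {}" by (simp add: vempty_def elts_set_of)

lemma elts_eq_empty [simp]: "elts x = {} \<longleftrightarrow> x = vempty"
  using elts_inject elts_vempty by metis

lemma is_set_image:
  assumes "dft (\<lambda>e. F (e 0))"
  shows "is_set (F ` elts a)"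
proof -
  have "{p. \<exists>x. p = pair x (F x)} \<in> Cls"
    by (rule dfp_Collect) (intro df dft_subst1[OF assms])
  from replacement[OF this, of a] obtain b
    where "elts b = {y. \<exists>x\<in>elts a. pair x y \<in> {p. \<exists>x. p = pair x (F x)}}" by auto
  then have "elts b = F ` elts a" by auto
  then show ?thesis by (auto simp: is_set_def)
qed

lemma is_set_Union: "is_set (\<Union>y\<in>elts x. elts y)"
  using union unfolding is_set_def .



lemma is_set_Un: "is_set (elts x \<union> elts y)"
  using is_set_Union[of "upair x y"] by (simp add: elts_set_of)

lemma is_set_UnI: "is_set A \<Longrightarrow> is_set B \<Longrightarrow> is_set (A \<union> B)"
  using is_set_Un unfolding is_set_def by metis

lemma is_set_insert [simp]: "is_set (insert x (elts y))"
  using is_set_UnI[OF is_set_singleton[of x] is_set_elts[of y]] by simp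

lemma elts_vsucc [simp]: "elts (vsucc x) = insert x (elts x)"
  by (simp add: vsucc_def elts_set_of)

lemma dft_vsucc [df]: "dft t \<Longrightarrow> dft (\<lambda>e. vsucc (t e))"
proof (rule dft_subst1[of vsucc])
  have *: "{z. z = x \<or> z \<in> elts x} = insert x (elts x)" for x by auto
  have "dft (\<lambda>e. set_of {y. y = e 0 \<or> y \<in> elts (e 0)})"
    by (rule dft_set_of, simp add: *) (intro df)
  then show "dft (\<lambda>e. vsucc (e 0))" unfolding vsucc_def by (simp only: *)
qed

lemma elts_vinter [simp]: "elts (vinter x y) = elts x \<inter> elts y"
proof -
  have "is_set (elts x \<inter> elts y)"
    by (rule is_set_sep[of "\<lambda>z. z \<in> elts y" _ x]) (auto intro!: df)
  then show ?thesis by (simp add: vinter_def elts_set_of)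
qed

lemma elts_vdiff [simp]: "elts (vdiff x y) = elts x - elts y"
proof -
  have "is_set (elts x - elts y)"
    by (rule is_set_sep[of "\<lambda>z. z \<notin> elts y" _ x]) (auto intro!: df)
  then show ?thesis by (simp add: vdiff_def elts_set_of)
qed

text \<open>Replacement handles one argument at a time: it is applied to \<open>F u\<close> for each
  \<open>u\<close>, then to \<open>G\<close>, and the union axiom merges the rows.\<close>

lemma is_set_image2:
  assumes "dft (\<lambda>e. F (e 0) (e (Suc 0)))"
  shows "is_set {F u v | u v. u \<in> elts a \<and> v \<in> elts b}"
proof -
  define G where "G u = set_of {y. \<exists>v\<in>elts b. y = F u v}" for u
  have dF: "dft s \<Longrightarrow> dft t \<Longrightarrow> dft (\<lambda>e. F (s e) (t e))" for s t by (rule dft_subst2[OF assms])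
  have s: "is_set {y. \<exists>v\<in>elts b. y = F u v}" for u
    using is_set_image[of "F u" b] dF by (auto simp: image_def intro!: df)
  have "dft (\<lambda>e. G (e 0))" unfolding G_def
    by (rule dft_set_of[OF s]) (intro df dF)
  then obtain g where "elts g = G ` elts a" using is_set_image unfolding is_set_def by blast
  then have "(\<Union>y\<in>elts g. elts y) = {F u v | u v. u \<in> elts a \<and> v \<in> elts b}"
    using elts_set_of[OF s] by (auto simp: G_def)
  then show ?thesis using is_set_Union by metis
qed

definition vprod :: "'v \<Rightarrow> 'v \<Rightarrow> 'v" where
  "vprod a b = set_of {pair u v | u v. u \<in> elts a \<and> v \<in> elts b}"

lemma elts_vprod: "elts (vprod a b) = {pair u v | u v. u \<in> elts a \<and> v \<in> elts b}"
  unfolding vprod_def by (intro elts_set_of is_set_image2 df)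

lemma pair_in_vprod [simp]: "pair x y \<in> elts (vprod a b) \<longleftrightarrow> x \<in> elts a \<and> y \<in> elts b"
  by (auto simp: elts_vprod)

lemma elts_disj_sum: "elts (disj_sum x y) = pair vempty ` elts x \<union> pair (vsucc vempty) ` elts y"
  unfolding disj_sum_def by (intro elts_set_of is_set_UnI is_set_image df)

section \<open>Functions\<close>

text \<open>\<open>app\<close> is a \<open>THE\<close> with uncontrolled values off the domain.
  \<open>vapp\<close> agrees with it where the value is unique and returns \<open>vempty\<close>
  elsewhere, which makes it definable.\<close>

definition vapp :: "'v \<Rightarrow> 'v \<Rightarrow> 'v" where
  "vapp f x = vthe (\<lambda>y. mem (pair x y) f)"

lemma dft_vapp [df]: "dft s \<Longrightarrow> dft t \<Longrightarrow> dft (\<lambda>e. vapp (s e) (t e))"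
  unfolding vapp_def
  by (rule dft_subst2[of "\<lambda>f x. vthe (\<lambda>y. mem (pair x y) f)"]) (intro df)+

lemma app_eq_vapp: "is_fun_on f d \<Longrightarrow> x \<in> elts d \<Longrightarrow> app f x = vapp f x"
  unfolding is_fun_on_def app_def vapp_def vthe_def by simp

text \<open>Replacement makes the restriction of a definable class function to a set an internal
  function; this is the bridge from HOL functions to members of the universe.\<close>

lemma ex_vapp:
  assumes "dft (\<lambda>e. F (e 0))"
  obtains f where "is_fun_on f d" "\<And>x. x \<in> elts d \<Longrightarrow> vapp f x = F x"
    "\<And>x. x \<in> elts d \<Longrightarrow> app f x = F x"
proof -
  have "is_set ((\<lambda>x. pair x (F x)) ` elts d)" by (intro is_set_image df dft_subst1[OF assms])
  then obtain f where f: "elts f = (\<lambda>x. pair x (F x)) ` elts d" unfolding is_set_def by blast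
  have m: "mem (pair x y) f \<longleftrightarrow> x \<in> elts d \<and> y = F x" for x y
    by (auto simp: mem_elts f)
  have "is_fun_on f d" unfolding is_fun_on_def f by (auto simp: m)
  moreover have "vapp f x = F x" if "x \<in> elts d" for x
    unfolding vapp_def using that m by (intro vthe_eq) auto
  ultimately show ?thesis using app_eq_vapp that by metis
qed

lemma ex_vapp_eq: "dft (\<lambda>e. F (e 0)) \<Longrightarrow> \<exists>f. \<forall>x\<in>elts d. vapp f x = F x"
  by (metis ex_vapp)

lemma dfp_is_fun_on [df]: "dft s \<Longrightarrow> dft t \<Longrightarrow> dfp (\<lambda>e. is_fun_on (s e) (t e))"
  unfolding is_fun_on_def
  by (rule dfp_subst2[of "\<lambda>f d. (\<forall>p\<in>elts f. \<exists>x\<in>elts d. \<exists>y. p = pair x y) \<and>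
     (\<forall>x\<in>elts d. \<exists>!y. mem (pair x y) f)"]) (intro df)+

lemma eqpoll_alt: "eqpoll x y \<longleftrightarrow> (\<exists>f. is_fun_on f x \<and>
    (\<forall>u\<in>elts x. vapp f u \<in> elts y) \<and> (\<forall>u\<in>elts x. \<forall>v\<in>elts x. vapp f u = vapp f v \<longrightarrow> u = v) \<and>
    (\<forall>w\<in>elts y. \<exists>u\<in>elts x. w = vapp f u))" (is "_ \<longleftrightarrow> (\<exists>f. _ \<and> ?Q f)")
proof -
  have "is_fun_on f x \<Longrightarrow> bij_betw (app f) (elts x) (elts y) = bij_betw (vapp f) (elts x) (elts y)" for f
    by (intro bij_betw_cong app_eq_vapp)
  moreover have "bij_betw (vapp f) (elts x) (elts y) = ?Q f" for f
    by (auto simp: bij_betw_def inj_on_def)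
  ultimately show ?thesis unfolding eqpoll_def by auto
qed

lemma dfp_eqpoll [df]: "dft s \<Longrightarrow> dft t \<Longrightarrow> dfp (\<lambda>e. eqpoll (s e) (t e))"
  unfolding eqpoll_alt
  by (rule dfp_subst2[of "\<lambda>x y. \<exists>f. is_fun_on f x \<and>
    (\<forall>u\<in>elts x. vapp f u \<in> elts y) \<and> (\<forall>u\<in>elts x. \<forall>v\<in>elts x. vapp f u = vapp f v \<longrightarrow> u = v) \<and>
    (\<forall>w\<in>elts y. \<exists>u\<in>elts x. w = vapp f u)"]) (intro df)+

lemma eqpollI:
  assumes "dft (\<lambda>e. F (e 0))" "bij_betw F (elts x) (elts y)"
  shows "eqpoll x y"
proof -
  obtain f where f: "is_fun_on f x" "\<And>u. u \<in> elts x \<Longrightarrow> app f u = F u" using ex_vapp[OF assms(1)] by metis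
  then have "bij_betw (app f) (elts x) (elts y)" using assms(2) bij_betw_cong by blast
  then show ?thesis using f unfolding eqpoll_def by blast
qed

lemma eqpollE:
  assumes "eqpoll x y"
  obtains f where "is_fun_on f x" "bij_betw (vapp f) (elts x) (elts y)"
  using assms app_eq_vapp bij_betw_cong unfolding eqpoll_def by metis

section \<open>Ordinals\<close>

lemma ex_minimal:
  assumes "dfp (\<lambda>e. P (e 0))" "x \<in> elts a" "P x"
  obtains y where "y \<in> elts a" "P y" "\<And>z. z \<in> elts y \<Longrightarrow> z \<in> elts a \<Longrightarrow> \<not> P z"
proof -
  obtain s where s: "elts s = {x \<in> elts a. P x}"
    using is_set_Collect[OF assms(1)] unfolding is_set_def by metis
  then have "elts s \<noteq> {}" using assms(2,3) by blast
  from foundation[OF this] obtain y where "y \<in> elts s" "elts y \<inter> elts s = {}" by blast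
  then show ?thesis using s that by blast
qed

lemma mem_irrefl [simp]: "x \<notin> elts x"
  using foundation[of "upair x x"] by auto

lemma mem_asym: "x \<in> elts y \<Longrightarrow> y \<notin> elts x"
  using foundation[of "upair x y"] by auto

lemma dfp_transitive [df]: "dft t \<Longrightarrow> dfp (\<lambda>e. transitive (t e))"
  unfolding transitive_def by (rule dfp_subst1[of "\<lambda>x. \<forall>y\<in>elts x. elts y \<subseteq> elts x"]) (intro df)+

lemma dfp_ordinal [df]: "dft t \<Longrightarrow> dfp (\<lambda>e. ordinal (t e))"
  unfolding ordinal_def by (rule dfp_subst1[of "\<lambda>x. transitive x \<and> (\<forall>y\<in>elts x. transitive y)"]) (intro df)+

lemma dfp_ord_le [df]: "dft s \<Longrightarrow> dft t \<Longrightarrow> dfp (\<lambda>e. ord_le (s e) (t e))"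
  unfolding ord_le_def by (intro df)

lemma ord_le_iff: "ord_le a b \<longleftrightarrow> a \<in> elts b \<or> a = b"
  by (simp add: ord_le_def elts_def)

lemma ordinal_mem: "ordinal a \<Longrightarrow> b \<in> elts a \<Longrightarrow> ordinal b"
  unfolding ordinal_def transitive_def by blast

lemma ordinal_trans: "ordinal a \<Longrightarrow> b \<in> elts a \<Longrightarrow> c \<in> elts b \<Longrightarrow> c \<in> elts a"
  unfolding ordinal_def transitive_def by blast

lemma ordinal_mem_subset: "ordinal a \<Longrightarrow> b \<in> elts a \<Longrightarrow> elts b \<subseteq> elts a"
  using ordinal_trans by blast

lemma ordinal_vempty [simp]: "ordinal vempty"
  by (simp add: ordinal_def transitive_def)

lemma ordinal_vsucc: "ordinal a \<Longrightarrow> ordinal (vsucc a)"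
  unfolding ordinal_def transitive_def by auto

lemma ordinalI: "(\<And>y z. y \<in> elts x \<Longrightarrow> z \<in> elts y \<Longrightarrow> z \<in> elts x) \<Longrightarrow> (\<And>y. y \<in> elts x \<Longrightarrow> ordinal y) \<Longrightarrow> ordinal x"
  unfolding ordinal_def transitive_def by blast

lemma ordinal_induct [consumes 2, case_names step]:
  assumes P: "dfp (\<lambda>e. P (e 0))" and a: "ordinal a"
    and step: "\<And>a. ordinal a \<Longrightarrow> (\<And>b. b \<in> elts a \<Longrightarrow> P b) \<Longrightarrow> P a"
  shows "P a"
proof (rule ccontr)
  assume n: "\<not> P a"
  \<comment> \<open>The minimal counterexample is sought in \<open>vsucc a\<close>, so that
    \<open>a\<close> itself is a candidate.\<close>
  obtain y where y: "y \<in> elts (vsucc a)" "\<not> P y"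
    "\<And>z. z \<in> elts y \<Longrightarrow> z \<in> elts (vsucc a) \<Longrightarrow> \<not> \<not> P z"
    by (rule ex_minimal[of "\<lambda>x. \<not> P x" a "vsucc a"]) (use n in \<open>auto intro!: df P\<close>)
  have o: "ordinal y" using y(1) ordinal_mem ordinal_vsucc a by blast
  have "P y" using y ordinal_trans[OF ordinal_vsucc[OF a]] by (intro step[OF o]) blast
  then show False using y by simp
qed

text \<open>Double induction: if \<open>a\<close> and \<open>b\<close> were incomparable, the two
  hypotheses would force each element of one into the other, and extensionality would identify
  them.\<close>

lemma ordinal_linear:
  assumes "ordinal a" "ordinal b"
  shows "a \<in> elts b \<or> a = b \<or> b \<in> elts a"
proof -
  let ?C = "\<lambda>a b. a \<in> elts b \<or> a = b \<or> b \<in> elts a"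
  have "\<forall>b. ordinal b \<longrightarrow> ?C a b"
  proof (rule ordinal_induct[OF _ assms(1), where P = "\<lambda>a. \<forall>b. ordinal b \<longrightarrow> ?C a b"], intro df)
    fix a assume a: "ordinal a" and IH: "\<And>x. x \<in> elts a \<Longrightarrow> \<forall>b. ordinal b \<longrightarrow> ?C x b"
    show "\<forall>b. ordinal b \<longrightarrow> ?C a b"
    proof (intro allI impI)
      fix b assume "ordinal b"
      then show "?C a b"
      proof (rule ordinal_induct[rotated, where P = "\<lambda>b. ?C a b"])
        fix b assume b: "ordinal b" and IH': "\<And>y. y \<in> elts b \<Longrightarrow> ?C a y"
        show "?C a b"
        proof (rule ccontr)
          assume n: "\<not> ?C a b"
          have "elts a \<subseteq> elts b"
            using IH b n ordinal_trans[OF a] by blast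
          moreover have "elts b \<subseteq> elts a"
            using IH' n ordinal_trans[OF b] by blast
          ultimately show False using n elts_inject by blast
        qed
      qed (intro df)
    qed
  qed
  then show ?thesis using assms(2) by blast
qed

lemma ord_le_iff_subset:
  assumes "ordinal a" "ordinal b"
  shows "ord_le a b \<longleftrightarrow> elts a \<subseteq> elts b"
proof
  show "ord_le a b \<Longrightarrow> elts a \<subseteq> elts b"
    using ordinal_mem_subset[OF assms(2)] by (auto simp: ord_le_iff)
  show "elts a \<subseteq> elts b \<Longrightarrow> ord_le a b"
    using ordinal_linear[OF assms] mem_irrefl by (auto simp: ord_le_iff)
qed

lemma ord_le_refl [simp]: "ord_le a a" by (simp add: ord_le_def)

lemma ord_le_linear: "ordinal a \<Longrightarrow> ordinal b \<Longrightarrow> ord_le a b \<or> b \<in> elts a"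
  using ordinal_linear by (auto simp: ord_le_iff)

lemma ord_le_antisym: "ord_le a b \<Longrightarrow> ord_le b a \<Longrightarrow> a = b"
  using mem_asym by (auto simp: ord_le_iff)

lemma ord_le_trans: "ordinal c \<Longrightarrow> ord_le a b \<Longrightarrow> ord_le b c \<Longrightarrow> ord_le a c"
  using ordinal_trans by (auto simp: ord_le_iff)

lemma ord_le_mem_trans: "ordinal c \<Longrightarrow> ord_le a b \<Longrightarrow> b \<in> elts c \<Longrightarrow> a \<in> elts c"
  using ordinal_trans by (auto simp: ord_le_iff)

lemma ordinal_vsucc_cases:
  assumes "ordinal a" "b \<in> elts a"
  shows "vsucc b \<in> elts a \<or> vsucc b = a"
proof -
  have "ordinal b" using ordinal_mem assms .
  from ordinal_linear[OF ordinal_vsucc[OF this] assms(1)] show ?thesis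
    using assms mem_asym[OF assms(2)] by auto
qed

lemma least_ord_eqI:
  assumes "ordinal a" "P a" "\<And>b. ordinal b \<Longrightarrow> P b \<Longrightarrow> ord_le a b"
  shows "least_ord P = a"
  unfolding least_ord_def
  by (rule the_equality) (use assms ord_le_antisym in auto)

lemma least_ord:
  assumes P: "dfp (\<lambda>e. P (e 0))" and a: "ordinal a" "P a"
  shows "ordinal (least_ord P)" "P (least_ord P)" "\<And>b. ordinal b \<Longrightarrow> P b \<Longrightarrow> ord_le (least_ord P) b"
proof -
  obtain y where y: "y \<in> elts (vsucc a)" "P y"
    "\<And>z. z \<in> elts y \<Longrightarrow> z \<in> elts (vsucc a) \<Longrightarrow> \<not> P z"
    by (rule ex_minimal[OF P, of a "vsucc a"]) (use a in auto)
  have o: "ordinal y" using y(1) ordinal_mem ordinal_vsucc a by blast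
  have le: "ord_le y b" if "ordinal b" "P b" for b
    using ord_le_linear[OF o that(1)] y that(2) ordinal_trans[OF ordinal_vsucc[OF a(1)] y(1)] by blast
  have "least_ord P = y" by (rule least_ord_eqI) (use o y le in auto)
  then show "ordinal (least_ord P)" "P (least_ord P)"
    "\<And>b. ordinal b \<Longrightarrow> P b \<Longrightarrow> ord_le (least_ord P) b"
    using o y le by auto
qed

section \<open>The well-ordering theorem\<close>

text \<open>The axiom concerns disjoint families, so each nonempty subset \<open>s\<close> is
  replaced by the product of \<open>{s}\<close> and \<open>s\<close>. A transversal may contain
  alien elements; cut down to pairs \<open>pair s v\<close> with \<open>v\<close> in
  \<open>s\<close>, it is a choice function.\<close>

lemma ex_choice: "\<exists>c. \<forall>s. elts s \<subseteq> elts x \<longrightarrow> s \<noteq> vempty \<longrightarrow> vapp c s \<in> elts s"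
proof -
  define G where "G s = set_of {p. \<exists>v\<in>elts s. p = pair s v}" for s
  have s: "is_set {p. \<exists>v\<in>elts s. p = pair s v}" for s
  proof -
    have "is_set (pair s ` elts s)" by (rule is_set_image) (intro df)
    moreover have "pair s ` elts s = {p. \<exists>v\<in>elts s. p = pair s v}" by auto
    ultimately show ?thesis by simp
  qed
  have dG: "dft (\<lambda>e. G (e 0))" unfolding G_def by (rule dft_set_of[OF s]) (intro df)
  have eG: "elts (G s) = {p. \<exists>v\<in>elts s. p = pair s v}" for s
    unfolding G_def by (rule elts_set_of[OF s])
  obtain pw where pw: "elts pw = {y. elts y \<subseteq> elts x}" using power_set by blast
  have "is_set {s \<in> elts pw. s \<noteq> vempty}" by (rule is_set_Collect) (intro df)
  then obtain pw' where pw': "elts pw' = {s \<in> elts pw. s \<noteq> vempty}" unfolding is_set_def by blast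
  obtain fm where fm: "elts fm = G ` elts pw'" using is_set_image[OF dG] unfolding is_set_def by metis
  have "\<exists>t. \<forall>y\<in>elts fm. \<exists>!u. u \<in> elts t \<inter> elts y"
    by (rule choice) (auto simp: fm eG pw' simp flip: elts_eq_empty)
  then obtain t where t: "\<forall>y\<in>elts fm. \<exists>!u. u \<in> elts t \<inter> elts y" by blast
  have t: "\<exists>!u. u \<in> elts t \<inter> elts (G s)" if "s \<in> elts pw'" for s
    by (rule bspec[OF t]) (simp add: fm that)
  have "is_set {p \<in> elts t. \<exists>s. \<exists>v\<in>elts s. p = pair s v}" by (rule is_set_Collect) (intro df)
  then obtain c where c: "elts c = {p \<in> elts t. \<exists>s. \<exists>v\<in>elts s. p = pair s v}"
    unfolding is_set_def by blast
  have "vapp c s \<in> elts s" if "elts s \<subseteq> elts x" "s \<noteq> vempty" for s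
  proof -
    have "s \<in> elts pw'" using that pw pw' by simp
    from t[OF this] obtain p where p: "p \<in> elts t" "p \<in> elts (G s)"
      and uniq: "\<And>q. q \<in> elts t \<Longrightarrow> q \<in> elts (G s) \<Longrightarrow> q = p" by (metis IntE IntI)
    from p(2) obtain v where v: "v \<in> elts s" "p = pair s v" unfolding eG by blast
    have u: "w = v" if "w \<in> elts s" "pair s w \<in> elts t" for w
      using uniq[of "pair s w"] that by (simp add: eG v)
    have "mem (pair s w) c \<longleftrightarrow> pair s w \<in> elts t \<and> w \<in> elts s" for w
      by (auto simp: mem_elts c)
    then have "vapp c s = v" unfolding vapp_def using v p u by (intro vthe_eq) blast+
    then show ?thesis using v by simp
  qed
  then show ?thesis by blast
qed

text \<open>What remains of \<open>x\<close> at stage \<open>b\<close> of an enumeration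
  \<open>g\<close>; the next value is chosen from it.\<close>

definition vrest :: "'v \<Rightarrow> 'v \<Rightarrow> 'v \<Rightarrow> 'v" where
  "vrest x g b = vthe (\<lambda>z. \<forall>y. mem y z \<longleftrightarrow> mem y x \<and> (\<forall>d\<in>elts b. vapp g d \<noteq> y))"

lemma elts_vrest: "elts (vrest x g b) = {y \<in> elts x. \<forall>d\<in>elts b. vapp g d \<noteq> y}" (is "_ = ?S")
proof -
  have "is_set ?S" by (rule is_set_Collect) (intro df)
  then obtain z where z: "elts z = ?S" unfolding is_set_def by blast
  have "vrest x g b = z" unfolding vrest_def
    by (rule vthe_eq) (use z in \<open>auto simp: mem_elts simp flip: elts_inject\<close>)
  then show ?thesis using z by simp
qed

lemma dft_vrest [df]: "dft s \<Longrightarrow> dft t \<Longrightarrow> dft (\<lambda>e. vrest x (s e) (t e))"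
  unfolding vrest_def
  by (rule dft_subst2[of "\<lambda>g b. vthe (\<lambda>z. \<forall>y. mem y z \<longleftrightarrow> mem y x \<and> (\<forall>d\<in>elts b. vapp g d \<noteq> y))"]) (intro df)+

text \<open>
  Attempts agree on common ordinals and are injective, so the position of an element of \<open>x\<close> in an
  attempt is a partial class function on \<open>x\<close>; by replacement its range is an ordinal, and the
  attempts glue to an enumeration of \<open>x\<close> along it.
\<close>

definition attempt :: "'v \<Rightarrow> 'v \<Rightarrow> 'v \<Rightarrow> 'v \<Rightarrow> bool" where
  "attempt c x g a \<longleftrightarrow> ordinal a \<and>
     (\<forall>b\<in>elts a. vrest x g b \<noteq> vempty \<and> vapp g b = vapp c (vrest x g b))"

lemma dfp_attempt [df]: "dft s \<Longrightarrow> dft t \<Longrightarrow> dfp (\<lambda>e. attempt c x (s e) (t e))"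
  unfolding attempt_def
  by (rule dfp_subst2[of "\<lambda>g a. ordinal a \<and>
     (\<forall>b\<in>elts a. vrest x g b \<noteq> vempty \<and> vapp g b = vapp c (vrest x g b))"]) (intro df)+

lemma vrest_cong: "(\<And>d. d \<in> elts b \<Longrightarrow> vapp g d = vapp g' d) \<Longrightarrow> vrest x g b = vrest x g' b"
  by (simp add: elts_vrest flip: elts_inject)

lemma attempt_agree:
  assumes "attempt c x g a" "attempt c x g' a'" "b \<in> elts a" "b \<in> elts a'"
  shows "vapp g b = vapp g' b"
proof -
  have "ordinal b" using assms ordinal_mem by (auto simp: attempt_def)
  then have "b \<in> elts a \<and> b \<in> elts a' \<longrightarrow> vapp g b = vapp g' b"
  proof (rule ordinal_induct[where P = "\<lambda>b. b \<in> elts a \<and> b \<in> elts a' \<longrightarrow> vapp g b = vapp g' b", rotated])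
    fix b assume IH: "\<And>d. d \<in> elts b \<Longrightarrow> d \<in> elts a \<and> d \<in> elts a' \<longrightarrow> vapp g d = vapp g' d"
    show "b \<in> elts a \<and> b \<in> elts a' \<longrightarrow> vapp g b = vapp g' b"
    proof
      assume b: "b \<in> elts a \<and> b \<in> elts a'"
      then have "vrest x g b = vrest x g' b"
        using IH assms(1,2) ordinal_trans by (intro vrest_cong) (auto simp: attempt_def)
      then show "vapp g b = vapp g' b" using b assms by (simp add: attempt_def)
    qed
  qed (intro df)
  then show ?thesis using assms by blast
qed

lemma well_ordering: obtains a where "ordinal a" "eqpoll a x"
proof -
  obtain c where c: "\<And>s. elts s \<subseteq> elts x \<Longrightarrow> s \<noteq> vempty \<Longrightarrow> vapp c s \<in> elts s"
    using ex_choice[of x] by blast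
  have sub: "elts (vrest x g b) \<subseteq> elts x" for g b by (auto simp: elts_vrest)
  have val: "vapp g b \<in> elts x" "\<And>d. d \<in> elts b \<Longrightarrow> vapp g d \<noteq> vapp g b"
    if "attempt c x g a" "b \<in> elts a" for g a b
  proof -
    have "vapp g b \<in> elts (vrest x g b)" using c[OF sub] that by (simp add: attempt_def)
    then show "vapp g b \<in> elts x" "\<And>d. d \<in> elts b \<Longrightarrow> vapp g d \<noteq> vapp g b"
      by (auto simp: elts_vrest)
  qed
  have dom: "attempt c x g (vsucc b)" if "attempt c x g a" "b \<in> elts a" for g a b
    using that ordinal_mem[of a b] ordinal_trans[of a b] ordinal_vsucc[of b] by (auto simp: attempt_def)
  let ?R = "\<lambda>y b. \<exists>g. attempt c x g (vsucc b) \<and> y = vapp g b"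
  have R_inj: "b = b'" if R: "?R y b" "?R y b'" for y b b'
  proof -
    from R obtain g g' where g: "attempt c x g (vsucc b)" "y = vapp g b"
      and g': "attempt c x g' (vsucc b')" "y = vapp g' b'" by blast
    have "\<not> b \<in> elts b'" using attempt_agree[OF g(1) g'(1), of b] val(2)[OF g'(1), of b' b] g g' by auto
    moreover have "\<not> b' \<in> elts b" using attempt_agree[OF g(1) g'(1), of b'] val(2)[OF g(1), of b b'] g g' by auto
    moreover have "ordinal b" "ordinal b'"
      using g g' ordinal_mem[of "vsucc b" b] ordinal_mem[of "vsucc b'" b'] by (auto simp: attempt_def)
    ultimately show ?thesis using ordinal_linear by blast
  qed
  let ?C = "{p. \<exists>y b. ?R y b \<and> p = pair y b}"
  have C: "?C \<in> Cls" by (rule dfp_Collect) (intro df)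
  have "\<forall>y b b'. pair y b \<in> ?C \<and> pair y b' \<in> ?C \<longrightarrow> b = b'"
    using R_inj by auto
  from replacement[OF C this, of x] obtain a where a: "elts a = {b. \<exists>y\<in>elts x. pair y b \<in> ?C}" by blast
  have a_iff: "b \<in> elts a \<longleftrightarrow> (\<exists>g. attempt c x g (vsucc b))" for b
    unfolding a using val(1)[of _ "vsucc b" b] by auto
  have oa: "ordinal a"
  proof (rule ordinalI)
    fix b assume "b \<in> elts a"
    then show "ordinal b" using a_iff ordinal_mem[of "vsucc b" b] by (auto simp: attempt_def)
    fix d assume "d \<in> elts b"
    then show "d \<in> elts a" using \<open>b \<in> elts a\<close> dom[of _ "vsucc b" d] by (auto simp: a_iff)
  qed
  define F where "F b = vthe (\<lambda>y. ?R y b)" for b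
  have dF: "dft (\<lambda>e. F (e 0))" unfolding F_def by (intro df)
  have F: "F b = vapp g b" if "attempt c x g (vsucc b)" for b g
    unfolding F_def
  proof (rule vthe_eq)
    show "?R (vapp g b) b" using that by blast
    fix y assume "?R y b"
    then obtain g' where g': "attempt c x g' (vsucc b)" "y = vapp g' b" by blast
    then show "y = vapp g b" using attempt_agree[OF g'(1) that, of b] by simp
  qed
  obtain f where f: "is_fun_on f a" "\<And>b. b \<in> elts a \<Longrightarrow> vapp f b = F b" using ex_vapp[OF dF] by metis
  have fg: "vapp f d = vapp g d" if "attempt c x g (vsucc b)" "d \<in> elts (vsucc b)" for b d g
    using f(2)[of d] dom[OF that] F a_iff by auto
  have att: "attempt c x f a" unfolding attempt_def
  proof (intro conjI ballI oa)
    fix b assume b: "b \<in> elts a"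
    then obtain g where g: "attempt c x g (vsucc b)" using a_iff by blast
    have r: "vrest x f b = vrest x g b" using fg[OF g] by (intro vrest_cong) simp
    show "vrest x f b \<noteq> vempty" using g by (simp add: r attempt_def)
    show "vapp f b = vapp c (vrest x f b)" using g fg[OF g, of b] by (simp add: r attempt_def)
  qed
  \<comment> \<open>If something of \<open>x\<close> were left, one more choice would give an
    attempt of length \<open>vsucc a\<close>, whose existence puts \<open>a\<close> into
    \<open>a\<close>.\<close>
  have full: "vrest x f a = vempty"
  proof (rule ccontr)
    assume ne: "vrest x f a \<noteq> vempty"
    have "dft (\<lambda>e. if e 0 = a then vapp c (vrest x f a) else vapp f (e 0))" by (intro df)
    from ex_vapp_eq[OF this, of "vsucc a"] obtain f' where
      "\<forall>b\<in>elts (vsucc a). vapp f' b = (if b = a then vapp c (vrest x f a) else vapp f b)" ..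
    then have f': "\<And>b. b \<in> elts (vsucc a) \<Longrightarrow>
        vapp f' b = (if b = a then vapp c (vrest x f a) else vapp f b)" by (rule bspec)
    have "attempt c x f' (vsucc a)" unfolding attempt_def
    proof (intro conjI ballI ordinal_vsucc oa)
      fix b assume b: "b \<in> elts (vsucc a)"
      have "d \<in> elts a" if "d \<in> elts b" for d using b that ordinal_trans[OF oa] by auto
      then have "d \<in> elts a \<and> d \<noteq> a" if "d \<in> elts b" for d using that mem_irrefl by blast
      then have r: "vrest x f' b = vrest x f b" using f' by (intro vrest_cong) simp
      show "vrest x f' b \<noteq> vempty" using b ne att by (auto simp: r attempt_def)
      show "vapp f' b = vapp c (vrest x f' b)" using b f'[OF b] att by (auto simp: r attempt_def)
    qed
    then have "a \<in> elts a" using a_iff by blast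
    then show False by simp
  qed
  have "bij_betw (vapp f) (elts a) (elts x)"
    unfolding bij_betw_def
  proof
    show "inj_on (vapp f) (elts a)"
    proof (rule inj_onI)
      fix u v assume *: "u \<in> elts a" "v \<in> elts a" "vapp f u = vapp f v"
      then have "ordinal u" "ordinal v" using ordinal_mem[OF oa] by auto
      from ordinal_linear[OF this] show "u = v"
        using val(2)[OF att *(1), of v] val(2)[OF att *(2), of u] * by auto
    qed
    have "elts x \<subseteq> vapp f ` elts a"
      using full unfolding elts_eq_empty[symmetric] elts_vrest by blast
    then show "vapp f ` elts a = elts x" using val(1)[OF att] by blast
  qed
  then have "eqpoll a x" by (rule eqpollI[rotated]) (intro df)
  then show ?thesis using that oa by blast
qed

section \<open>Cardinalities\<close>

definition lepoll :: "'v \<Rightarrow> 'v \<Rightarrow> bool" where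
  "lepoll x y \<longleftrightarrow> (\<exists>f. inj_on (vapp f) (elts x) \<and> vapp f ` elts x \<subseteq> elts y)"

lemma lepollI:
  assumes "dft (\<lambda>e. F (e 0))" "inj_on F (elts x)" "F ` elts x \<subseteq> elts y"
  shows "lepoll x y"
proof -
  obtain f where f: "\<And>u. u \<in> elts x \<Longrightarrow> vapp f u = F u" using ex_vapp[OF assms(1)] by metis
  then have "inj_on (vapp f) (elts x)" "vapp f ` elts x \<subseteq> elts y"
    using assms(2,3) by (auto simp: inj_on_def)
  then show ?thesis unfolding lepoll_def by blast
qed

lemma lepoll_subset: "elts x \<subseteq> elts y \<Longrightarrow> lepoll x y"
  by (rule lepollI[of "\<lambda>x. x"]) (auto intro!: df)

lemma lepoll_refl [simp]: "lepoll x x" by (simp add: lepoll_subset)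

lemma lepoll_trans:
  assumes "lepoll x y" "lepoll y z" shows "lepoll x z"
proof -
  from assms obtain f g where f: "inj_on (vapp f) (elts x)" "vapp f ` elts x \<subseteq> elts y"
    and g: "inj_on (vapp g) (elts y)" "vapp g ` elts y \<subseteq> elts z" unfolding lepoll_def by blast
  show ?thesis
  proof (rule lepollI[of "\<lambda>u. vapp g (vapp f u)"])
    show "inj_on (\<lambda>u. vapp g (vapp f u)) (elts x)"
      using comp_inj_on[OF f(1) inj_on_subset[OF g(1) f(2)]] by (simp add: comp_def)
  qed (use f g in \<open>auto intro!: df\<close>)
qed

lemma eqpoll_imp_lepoll: "eqpoll x y \<Longrightarrow> lepoll x y"
  by (erule eqpollE) (auto simp: lepoll_def bij_betw_def)

lemma eqpoll_sym:
  assumes "eqpoll x y" shows "eqpoll y x"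
proof -
  from assms obtain f where f: "bij_betw (vapp f) (elts x) (elts y)" by (rule eqpollE)
  define F where "F v = vthe (\<lambda>u. u \<in> elts x \<and> v = vapp f u)" for v
  have F: "F (vapp f u) = u" if "u \<in> elts x" for u
    unfolding F_def using f that by (intro vthe_eq) (auto simp: bij_betw_def inj_on_def)
  show ?thesis
  proof (rule eqpollI)
    show "dft (\<lambda>e. F (e 0))" unfolding F_def by (intro df)
    show "bij_betw F (elts y) (elts x)"
      using bij_betw_cong[of "elts y" F "inv_into (elts x) (vapp f)" "elts x"] bij_betw_inv_into[OF f]
        f F by (metis bij_betw_def f_inv_into_f inv_into_into)
  qed
qed

lemma eqpoll_refl [simp]: "eqpoll x x"
  by (rule eqpollI[of "\<lambda>u. u"]) (auto intro!: df simp: bij_betw_def)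

lemma eqpoll_trans:
  assumes "eqpoll x y" "eqpoll y z" shows "eqpoll x z"
proof -
  from assms obtain f g where f: "bij_betw (vapp f) (elts x) (elts y)"
    and g: "bij_betw (vapp g) (elts y) (elts z)" by (metis eqpollE)
  show ?thesis
    by (rule eqpollI[of "\<lambda>u. vapp g (vapp f u)"])
      (use bij_betw_trans[OF f g] in \<open>auto intro!: df simp: comp_def\<close>)
qed

text \<open>
  Schroeder--Bernstein: the bijection applies \<open>f\<close> to the points reachable from \<open>a - b\<close> by iterating
  \<open>f\<close>, and fixes all others.
\<close>

lemma eqpoll_of_subset:
  assumes "elts b \<subseteq> elts a" "lepoll a b"
  shows "eqpoll a b"
proof -
  from assms(2) obtain f where f: "inj_on (vapp f) (elts a)" "vapp f ` elts a \<subseteq> elts b"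
    unfolding lepoll_def by blast
  \<comment> \<open>Reachability is expressed as membership in every set that contains the starting
    points and is closed under \<open>f\<close>; this is a single formula, without recursion on the
    naturals.\<close>
  define C where "C x \<longleftrightarrow> (\<forall>s. (\<forall>y\<in>elts a. y \<notin> elts b \<longrightarrow> y \<in> elts s) \<and>
      (\<forall>y\<in>elts s. vapp f y \<in> elts s) \<longrightarrow> x \<in> elts s)" for x
  define F where "F x = (if C x then vapp f x else x)" for x
  have dC: "dfp (\<lambda>e. C (e 0))" unfolding C_def by (intro df)
  have C_start: "C y" if "y \<in> elts a" "y \<notin> elts b" for y
    using that unfolding C_def by blast
  have C_step: "C (vapp f y)" if "C y" for y using that unfolding C_def by blast
  have C_cases: "y \<notin> elts b \<or> (\<exists>x\<in>elts a. C x \<and> y = vapp f x)" if Cy: "C y" for y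
  proof (rule ccontr)
    assume n: "\<not> ?thesis"
    \<comment> \<open>If \<open>y\<close> lay in \<open>b\<close> and were no image of a reachable
      point of \<open>a\<close>, deleting it would leave a closed set, contrary to
      \<open>C y\<close>.\<close>
    have "is_set {x \<in> elts a. C x \<and> x \<noteq> y}" by (rule is_set_Collect) (intro df dC)
    then obtain s where s: "elts s = {x \<in> elts a. C x \<and> x \<noteq> y}" unfolding is_set_def by blast
    have s: "x \<in> elts s \<longleftrightarrow> x \<in> elts a \<and> C x \<and> x \<noteq> y" for x by (simp add: s)
    have "\<forall>y\<in>elts a. y \<notin> elts b \<longrightarrow> y \<in> elts s" using C_start n by (auto simp: s)
    moreover have "\<forall>x\<in>elts s. vapp f x \<in> elts s"
    proof
      fix x assume "x \<in> elts s"
      then have x: "x \<in> elts a" "C x" by (auto simp: s)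
      then have "vapp f x \<in> elts a" using f(2) assms(1) by blast
      moreover have "vapp f x \<noteq> y" using x n by blast
      ultimately show "vapp f x \<in> elts s" using C_step x by (simp add: s)
    qed
    ultimately have "y \<in> elts s" using Cy unfolding C_def by blast
    then show False using s by simp
  qed
  show ?thesis
  proof (rule eqpollI)
    show "dft (\<lambda>e. F (e 0))" unfolding F_def by (intro df dC)
    show "bij_betw F (elts a) (elts b)"
      unfolding bij_betw_def
    proof
      show "inj_on F (elts a)"
        using f(1) C_step unfolding inj_on_def F_def by metis
      show "F ` elts a = elts b"
      proof
        show "F ` elts a \<subseteq> elts b" using f(2) C_start by (auto simp: F_def)
        show "elts b \<subseteq> F ` elts a"
        proof
          fix y assume y: "y \<in> elts b"
          show "y \<in> F ` elts a"
          proof (cases "C y")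
            case True
            then obtain x where "x \<in> elts a" "C x" "y = vapp f x" using C_cases y by blast
            then show ?thesis by (auto simp: F_def)
          next
            case False
            then have "F y = y" by (simp add: F_def)
            then show ?thesis using y assms(1) by (metis image_eqI subsetD)
          qed
        qed
      qed
    qed
  qed
qed

lemma
  shows ordinal_vcard [simp]: "ordinal (vcard x)" and vcard_eqpoll: "eqpoll (vcard x) x"
    and vcard_le: "\<And>a. ordinal a \<Longrightarrow> eqpoll a x \<Longrightarrow> ord_le (vcard x) a"
proof -
  obtain a where a: "ordinal a" "eqpoll a x" by (rule well_ordering)
  have d: "dfp (\<lambda>e. eqpoll (e 0) x)" by (intro df)
  from least_ord[OF d a] show "ordinal (vcard x)" "eqpoll (vcard x) x"
    "\<And>a. ordinal a \<Longrightarrow> eqpoll a x \<Longrightarrow> ord_le (vcard x) a" by (auto simp: vcard_def)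
qed

lemma dft_vcard [df]: "dft t \<Longrightarrow> dft (\<lambda>e. vcard (t e))"
proof (rule dft_subst1[of vcard])
  have "y = vcard x \<longleftrightarrow> ordinal y \<and> eqpoll y x \<and> (\<forall>b. ordinal b \<and> eqpoll b x \<longrightarrow> ord_le y b)" for x y
    using ordinal_vcard vcard_eqpoll vcard_le ord_le_antisym by metis
  then show "dft (\<lambda>e. vcard (e 0))" unfolding dft_def by (simp only:) (intro df)
qed

lemma vcard_cong: "eqpoll x y \<Longrightarrow> vcard x = vcard y"
  by (meson eqpoll_sym eqpoll_trans ord_le_antisym ordinal_vcard vcard_eqpoll vcard_le)

lemma vcard_ordinal_le: "ordinal a \<Longrightarrow> ord_le (vcard a) a"
  using vcard_le by simp

lemma lepoll_vcard: "lepoll x (vcard x)" "lepoll (vcard x) x"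
  using vcard_eqpoll eqpoll_sym eqpoll_imp_lepoll by blast+

text \<open>A smaller cardinal for \<open>y\<close> would be a subset of the one for
  \<open>x\<close>, and Schroeder--Bernstein would then make the two equal.\<close>

lemma vcard_mono:
  assumes "lepoll x y"
  shows "ord_le (vcard x) (vcard y)"
proof (rule ccontr)
  assume n: "\<not> ord_le (vcard x) (vcard y)"
  then have "elts (vcard y) \<subseteq> elts (vcard x)"
    using ord_le_linear[of "vcard x" "vcard y"] ordinal_mem_subset[of "vcard x" "vcard y"] by simp
  moreover have "lepoll (vcard x) (vcard y)"
    using assms lepoll_vcard lepoll_trans by meson
  ultimately have "eqpoll (vcard x) (vcard y)" by (rule eqpoll_of_subset)
  then have "eqpoll x y" using vcard_eqpoll eqpoll_sym eqpoll_trans by meson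
  then show False using n vcard_cong by fastforce
qed

lemma lepoll_antisym_vcard: "lepoll x y \<Longrightarrow> lepoll y x \<Longrightarrow> vcard x = vcard y"
  using vcard_mono ord_le_antisym by blast

text \<open>The section of \<open>F\<close> takes the preimage of least index in an enumeration of
  \<open>x\<close> by its cardinal; minimality makes this choice definable.\<close>

lemma lepoll_image:
  assumes F: "dft (\<lambda>e. F (e 0))" and sub: "elts z \<subseteq> F ` elts x"
  shows "lepoll z x"
proof -
  obtain f where f: "bij_betw (vapp f) (elts (vcard x)) (elts x)" by (rule eqpollE[OF vcard_eqpoll])
  define G where "G v = vthe (\<lambda>b. b \<in> elts (vcard x) \<and> F (vapp f b) = v \<and>
      (\<forall>d\<in>elts b. F (vapp f d) \<noteq> v))" for v
  note dF = dft_subst1[OF F]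
  have dG: "dft (\<lambda>e. G (e 0))" unfolding G_def by (intro df dF)
  have G: "G v \<in> elts (vcard x)" "F (vapp f (G v)) = v" if v: "v \<in> elts z" for v
  proof -
    let ?P = "\<lambda>b. b \<in> elts (vcard x) \<and> F (vapp f b) = v"
    obtain u where u: "u \<in> elts x" "v = F u" using sub v by blast
    then obtain b where b: "?P b" using f unfolding bij_betw_def by (metis imageE)
    have dP: "dfp (\<lambda>e. ?P (e 0))" by (intro df dF)
    obtain b where b: "?P b" "\<And>d. d \<in> elts b \<Longrightarrow> d \<in> elts (vcard x) \<Longrightarrow> \<not> ?P d"
      using ex_minimal[OF dP, of b "vcard x"] b by blast
    have t: "d \<in> elts (vcard x)" if "d \<in> elts b'" "b' \<in> elts (vcard x)" for d b'
      using ordinal_trans[OF ordinal_vcard] that by blast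
    have "G v = b" unfolding G_def
    proof (rule vthe_eq)
      show "b \<in> elts (vcard x) \<and> F (vapp f b) = v \<and> (\<forall>d\<in>elts b. F (vapp f d) \<noteq> v)"
        using b t by blast
      fix b' assume b': "b' \<in> elts (vcard x) \<and> F (vapp f b') = v \<and> (\<forall>d\<in>elts b'. F (vapp f d) \<noteq> v)"
      have "ordinal b" "ordinal b'" using b b' ordinal_mem[OF ordinal_vcard] by blast+
      from ordinal_linear[OF this] show "b' = b" using b b' by blast
    qed
    then show "G v \<in> elts (vcard x)" "F (vapp f (G v)) = v" using b by auto
  qed
  have "lepoll z (vcard x)"
  proof (rule lepollI[OF dG])
    show "inj_on G (elts z)" using G(2) by (rule inj_on_inverseI)
  qed (use G in auto)
  then show ?thesis using lepoll_vcard lepoll_trans by blast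
qed

lemma lepoll_vprod_mono:
  assumes "lepoll a a'" "lepoll b b'"
  shows "lepoll (vprod a b) (vprod a' b')"
proof -
  from assms obtain f g where f: "inj_on (vapp f) (elts a)" "vapp f ` elts a \<subseteq> elts a'"
    and g: "inj_on (vapp g) (elts b)" "vapp g ` elts b \<subseteq> elts b'" unfolding lepoll_def by blast
  define F where "F p = vthe (\<lambda>q. \<exists>u v. p = pair u v \<and> q = pair (vapp f u) (vapp g v))" for p
  have F: "F (pair u v) = pair (vapp f u) (vapp g v)" for u v
    unfolding F_def by (rule vthe_eq) auto
  show ?thesis
  proof (rule lepollI)
    show "dft (\<lambda>e. F (e 0))" unfolding F_def by (intro df)
    show "inj_on F (elts (vprod a b))"
      using f(1) g(1) by (auto simp: inj_on_def elts_vprod F)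
    show "F ` elts (vprod a b) \<subseteq> elts (vprod a' b')"
      using f(2) g(2) by (auto simp: elts_vprod F image_subset_iff)
  qed
qed

section \<open>Natural numbers and countable sets\<close>

text \<open>\<open>omega\<close> is a \<open>set_of\<close>, meaningful because infinity supplies an
  inductive set from which the class of naturals can be separated.\<close>

lemma omega_iff: "n \<in> elts omega \<longleftrightarrow>
    (\<forall>i. vempty \<in> elts i \<and> (\<forall>m\<in>elts i. vsucc m \<in> elts i) \<longrightarrow> n \<in> elts i)" (is "_ = ?P n")
proof -
  obtain x where x: "\<exists>y\<in>elts x. elts y = {}"
    "\<forall>y\<in>elts x. \<exists>z\<in>elts x. elts z = insert y (elts y)" using infinity by blast
  have "vempty \<in> elts x" using x(1) by auto
  moreover have "vsucc y \<in> elts x" if "y \<in> elts x" for y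
    using x(2) that elts_vsucc elts_inject by metis
  ultimately have x_ind: "n \<in> elts x" if "?P n" for n using that by auto
  have "dfp (\<lambda>e. ?P (e 0))" by (intro df)
  then have "is_set (Collect ?P)" by (rule is_set_sep[of ?P _ x]) (use x_ind in auto)
  moreover have "omega = set_of (Collect ?P)" unfolding omega_def by (simp add: elts_def)
  ultimately show ?thesis by (simp add: elts_set_of)
qed

lemma vempty_in_omega [simp]: "vempty \<in> elts omega"
  unfolding omega_iff by simp

lemma vsucc_in_omega: "n \<in> elts omega \<Longrightarrow> vsucc n \<in> elts omega"
  unfolding omega_iff by blast

lemma omega_induct [consumes 2, case_names zero succ]:
  assumes P: "dfp (\<lambda>e. P (e 0))" and n: "n \<in> elts omega"
    and "P vempty" "\<And>n. n \<in> elts omega \<Longrightarrow> P n \<Longrightarrow> P (vsucc n)"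
  shows "P n"
proof -
  obtain i where i: "elts i = {n \<in> elts omega. P n}" using is_set_Collect[OF P] unfolding is_set_def by metis
  have "n \<in> elts i" using n[unfolded omega_iff, THEN spec, of i] assms(3,4) by (simp add: i vsucc_in_omega)
  then show ?thesis using i by simp
qed

lemma omega_mem: "n \<in> elts omega \<Longrightarrow> m \<in> elts n \<Longrightarrow> m \<in> elts omega"
proof -
  assume n: "n \<in> elts omega" and m: "m \<in> elts n"
  have "\<forall>m\<in>elts n. m \<in> elts omega"
    by (rule omega_induct[OF _ n]) (intro df, auto)
  then show ?thesis using m by blast
qed

lemma ordinal_nat: "n \<in> elts omega \<Longrightarrow> ordinal n"
  by (rule omega_induct[of ordinal]) (intro df, auto intro: ordinal_vsucc)

lemma ordinal_omega [simp]: "ordinal omega"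
  by (rule ordinalI) (use omega_mem ordinal_nat in auto)

lemma omega_cases:
  assumes "n \<in> elts omega"
  obtains "n = vempty" | m where "m \<in> elts omega" "n = vsucc m"
proof -
  have "n = vempty \<or> (\<exists>m\<in>elts omega. n = vsucc m)"
    by (rule omega_induct[OF _ assms]) (intro df, auto)
  then show ?thesis using that by blast
qed

lemma vsucc_inject [simp]: "vsucc a = vsucc b \<longleftrightarrow> a = b"
  using mem_asym[of a b] elts_vsucc by (metis insertE insertI1)

lemma vsucc_neq_vempty [simp]: "vsucc a \<noteq> vempty" "vempty \<noteq> vsucc a"
  using elts_vsucc elts_vempty by (metis empty_iff insertI1)+

lemma vempty_in_vsucc: "n \<in> elts omega \<Longrightarrow> vempty \<in> elts (vsucc n)"
  by (rule omega_induct[of "\<lambda>n. vempty \<in> elts (vsucc n)"]) (intro df, auto)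

lemma vsucc_mem_iff: "ordinal a \<Longrightarrow> vsucc b \<in> elts (vsucc a) \<longleftrightarrow> b \<in> elts a"
  using ordinal_vsucc_cases[of a b] ordinal_trans[of a "vsucc b" b] by auto

text \<open>The \<open>n\<close>-fold iterate of \<open>F\<close> at \<open>a\<close>. Recursion is
  expressed by quantifying over internal functions \<open>g\<close> that obey it up to
  \<open>n\<close>, so that the result is definable.\<close>

definition viter :: "('v \<Rightarrow> 'v) \<Rightarrow> 'v \<Rightarrow> 'v \<Rightarrow> 'v" where
  "viter F a n = vthe (\<lambda>y. \<exists>g. vapp g vempty = a \<and>
      (\<forall>i\<in>elts n. vapp g (vsucc i) = F (vapp g i)) \<and> y = vapp g n)"

lemma dft_viter:
  assumes F: "dft (\<lambda>e. F (e 0))" and "dft s" "dft t"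
  shows "dft (\<lambda>e. viter F (s e) (t e))"
  unfolding viter_def
  by (rule dft_subst2[of "\<lambda>a n. vthe (\<lambda>y. \<exists>g. vapp g vempty = a \<and>
      (\<forall>i\<in>elts n. vapp g (vsucc i) = F (vapp g i)) \<and> y = vapp g n)"])
    (intro df dft_subst1[OF F] assms)+

lemma
  assumes F: "dft (\<lambda>e. F (e 0))"
  shows viter_0: "viter F a vempty = a"
    and viter_vsucc: "n \<in> elts omega \<Longrightarrow> viter F a (vsucc n) = F (viter F a n)"
proof -
  let ?P = "\<lambda>g n. vapp g vempty = a \<and> (\<forall>i\<in>elts n. vapp g (vsucc i) = F (vapp g i))"
  note dF = dft_subst1[OF F]
  have uniq: "\<forall>g g'. ?P g n \<and> ?P g' n \<longrightarrow> vapp g n = vapp g' n" if "n \<in> elts omega" for n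
    by (rule omega_induct[OF _ that, where P = "\<lambda>n. \<forall>g g'. ?P g n \<and> ?P g' n \<longrightarrow> vapp g n = vapp g' n"])
      (intro df dF, simp, simp, metis)
  have ext: "\<exists>g'. ?P g' (vsucc n) \<and> vapp g' (vsucc n) = F (vapp g n)"
    if "n \<in> elts omega" "?P g n" for g n
  proof -
    have "dft (\<lambda>e. if e 0 = vsucc n then F (vapp g n) else vapp g (e 0))" by (intro df dF)
    from ex_vapp_eq[OF this, of "vsucc (vsucc n)"] obtain g' where
      "\<forall>i\<in>elts (vsucc (vsucc n)). vapp g' i = (if i = vsucc n then F (vapp g n) else vapp g i)" ..
    then have g': "\<And>i. i \<in> elts (vsucc (vsucc n)) \<Longrightarrow>
        vapp g' i = (if i = vsucc n then F (vapp g n) else vapp g i)" by (rule bspec)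
    have "?P g' (vsucc n)"
    proof (intro conjI ballI)
      show "vapp g' vempty = a" using g' vempty_in_vsucc[OF vsucc_in_omega] that by simp
      fix i assume i: "i \<in> elts (vsucc n)"
      have n: "ordinal (vsucc n)" "ordinal n" using ordinal_nat vsucc_in_omega that by auto
      have "i \<noteq> vsucc n" using i mem_irrefl by blast
      then show "vapp g' (vsucc i) = F (vapp g' i)"
        using g'[of "vsucc i"] g'[of i] i that n by (auto simp: vsucc_mem_iff simp del: elts_vsucc) auto
    qed
    then show ?thesis using g'[of "vsucc n"] by auto
  qed
  have ex: "\<exists>g. ?P g n" if "n \<in> elts omega" for n
  proof (rule omega_induct[OF _ that, where P = "\<lambda>n. \<exists>g. ?P g n"])
    show "dfp (\<lambda>e. \<exists>g. ?P g (e 0))" by (intro df dF)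
    have "dft (\<lambda>e. a)" by (intro df)
    from ex_vapp[OF this, of "vsucc vempty"] show "\<exists>g. ?P g vempty" by (metis elts_vempty elts_vsucc emptyE insertI1)
  qed (use ext in blast)
  have eq: "viter F a n = vapp g n" if "n \<in> elts omega" "?P g n" for g n
    unfolding viter_def by (rule vthe_eq) (use that uniq[OF that(1)] in blast)+
  show "viter F a vempty = a" using ex[of vempty] eq[of vempty] by auto
  assume n: "n \<in> elts omega"
  obtain g where g: "?P g n" using ex[OF n] by blast
  obtain g' where g': "?P g' (vsucc n) \<and> vapp g' (vsucc n) = F (vapp g n)" using ext[OF n g] by blast
  show "viter F a (vsucc n) = F (viter F a n)"
    using eq[OF n g] eq[OF vsucc_in_omega[OF n], of g'] g' by simp
qed

text \<open>
  A walk through \<open>\<omega> \<times> \<omega>\<close>: the shell of pairs with maximum \<open>n\<close> is traversed in the order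
  \<open>(0, n), \<dots>, (n, n), (n, 0), \<dots>, (n, n - 1)\<close>.  Unlike Cantor's enumeration this needs no addition.
\<close>

definition walk :: "'v \<Rightarrow> 'v" where
  "walk p = vthe (\<lambda>q. \<exists>m n. p = pair m n \<and>
     (m \<in> elts n \<and> q = pair (vsucc m) n \<or>
      m = n \<and> n = vempty \<and> q = pair vempty (vsucc vempty) \<or>
      m = n \<and> n \<noteq> vempty \<and> q = pair n vempty \<or>
      vsucc n \<in> elts m \<and> q = pair m (vsucc n) \<or>
      vsucc n = m \<and> q = pair vempty (vsucc m)))"

lemma dft_walk: "dft (\<lambda>e. walk (e 0))"
  unfolding walk_def by (intro df)

lemma walk_simps:
  assumes "ordinal m" "ordinal n"
  shows "m \<in> elts n \<Longrightarrow> walk (pair m n) = pair (vsucc m) n"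
    and "walk (pair vempty vempty) = pair vempty (vsucc vempty)"
    and "n \<noteq> vempty \<Longrightarrow> walk (pair n n) = pair n vempty"
    and "vsucc n \<in> elts m \<Longrightarrow> walk (pair m n) = pair m (vsucc n)"
    and "walk (pair (vsucc n) n) = pair vempty (vsucc (vsucc n))"
proof -
  have *: "vsucc n \<noteq> m \<and> vsucc n \<notin> elts m" if "m \<in> elts n"
    using mem_asym[OF that] ordinal_trans[OF assms(1), of "vsucc n" n] by auto
  have **: "vsucc n \<notin> elts n" "vsucc n \<noteq> n" "n \<noteq> vsucc n" using mem_asym[of n "vsucc n"]  by auto (metis elts_vsucc insertI1 mem_irrefl)+
  have ***: "vsucc n \<in> elts m \<Longrightarrow> m \<notin> elts n \<and> m \<noteq> n" using * ** by auto
  show "m \<in> elts n \<Longrightarrow> walk (pair m n) = pair (vsucc m) n"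
    unfolding walk_def by (rule vthe_eq) (use * mem_irrefl in auto)
  show "walk (pair vempty vempty) = pair vempty (vsucc vempty)"
    unfolding walk_def by (rule vthe_eq) auto
  show "n \<noteq> vempty \<Longrightarrow> walk (pair n n) = pair n vempty"
    unfolding walk_def by (rule vthe_eq) (use ** in auto)
  show "vsucc n \<in> elts m \<Longrightarrow> walk (pair m n) = pair m (vsucc n)"
    unfolding walk_def by (rule vthe_eq) (use *** in auto)
  show "walk (pair (vsucc n) n) = pair vempty (vsucc (vsucc n))"
    unfolding walk_def by (rule vthe_eq) (use ** in auto)
qed

text \<open>It suffices that the walk reaches every pair: \<open>lepoll_image\<close> turns a
  surjection from \<open>omega\<close> into the injection.\<close>

lemma omega_times_omega: "lepoll (vprod omega omega) omega"
proof -
  let ?I = "viter walk (pair vempty vempty)"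
  define V where "V m n \<longleftrightarrow> (\<exists>k\<in>elts omega. ?I k = pair m n)" for m n
  note dI = dft_viter[OF dft_walk]
  have dV: "dft s \<Longrightarrow> dft t \<Longrightarrow> dfp (\<lambda>e. V (s e) (t e))" for s t
    unfolding V_def by (rule dfp_subst2[of "\<lambda>m n. \<exists>k\<in>elts omega. ?I k = pair m n"]) (intro df dI)+
  have V0: "V vempty vempty" unfolding V_def using viter_0[OF dft_walk] vempty_in_omega by blast
  have V_step: "V m' n'" if "V m n" "walk (pair m n) = pair m' n'" for m n m' n'
    using that viter_vsucc[OF dft_walk] vsucc_in_omega unfolding V_def by metis
  note ord = ordinal_nat
  have col: "m \<in> elts (vsucc n) \<Longrightarrow> V m n" if n: "n \<in> elts omega" and "V vempty n" for m n
  proof -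
    assume m: "m \<in> elts (vsucc n)"
    then have "m \<in> elts omega" using omega_mem[OF vsucc_in_omega[OF n]] by blast
    then have "m \<in> elts (vsucc n) \<longrightarrow> V m n"
    proof (rule omega_induct[rotated, where P = "\<lambda>m. m \<in> elts (vsucc n) \<longrightarrow> V m n"])
      show "dfp (\<lambda>e. e 0 \<in> elts (vsucc n) \<longrightarrow> V (e 0) n)" by (intro df dV)
      fix m assume IH: "m \<in> elts omega" "m \<in> elts (vsucc n) \<longrightarrow> V m n"
      show "vsucc m \<in> elts (vsucc n) \<longrightarrow> V (vsucc m) n"
      proof
        assume "vsucc m \<in> elts (vsucc n)"
        then have "m \<in> elts n" using vsucc_mem_iff[OF ord[OF n]] by blast
        then show "V (vsucc m) n" using IH walk_simps(1)[OF ord ord, of m n] n V_step by auto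
      qed
    qed (use that in simp)
    then show ?thesis using m by blast
  qed
  have row: "m \<in> elts n \<Longrightarrow> V n m" if n: "n \<in> elts omega" and V: "V n n" for m n
  proof -
    assume m: "m \<in> elts n"
    then have ne: "n \<noteq> vempty" by auto
    have "m \<in> elts omega" using omega_mem[OF n m] .
    then have "m \<in> elts n \<longrightarrow> V n m"
    proof (rule omega_induct[rotated, where P = "\<lambda>m. m \<in> elts n \<longrightarrow> V n m"])
      show "dfp (\<lambda>e. e 0 \<in> elts n \<longrightarrow> V n (e 0))" by (intro df dV)
      show "vempty \<in> elts n \<longrightarrow> V n vempty"
        using V_step[OF V] walk_simps(3)[OF ord[OF n] ord[OF n] ne] by blast
      fix m assume IH: "m \<in> elts omega" "m \<in> elts n \<longrightarrow> V n m"
      show "vsucc m \<in> elts n \<longrightarrow> V n (vsucc m)"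
        using IH walk_simps(4)[OF ord[OF n] ord[OF IH(1)]] V_step ordinal_trans[OF ord[OF n], of "vsucc m" m] by auto
    qed
    then show ?thesis using m by blast
  qed
  \<comment> \<open>The last point of shell \<open>n = vsucc k\<close> is \<open>(n, k)\<close>,
    from which the walk enters the next shell. Shell 0 is a single point and has its own
    clause.\<close>
  have diag: "V vempty n" if "n \<in> elts omega" for n
  proof (rule omega_induct[OF _ that, where P = "V vempty"])
    show "dfp (\<lambda>e. V vempty (e 0))" by (intro df dV)
    fix n assume n: "n \<in> elts omega" and V: "V vempty n"
    from n show "V vempty (vsucc n)"
    proof (cases rule: omega_cases)
      case 1
      then show ?thesis using V0 V_step walk_simps(2) ordinal_vempty by blast
    next
      case (2 k)
      have "V n n" using col[OF n V] by simp
      then have "V n k" using row[OF n] 2 by simp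
      then show ?thesis using V_step walk_simps(5)[OF ord ord, OF 2(1) 2(1)] 2(2) by blast
    qed
  qed (rule V0)
  have all: "V m n" if m: "m \<in> elts omega" and n: "n \<in> elts omega" for m n
  proof (cases "m \<in> elts (vsucc n)")
    case True
    then show ?thesis using col[OF n diag[OF n]] by blast
  next
    case False
    then have "n \<in> elts m" using ordinal_linear[OF ord[OF m] ord[OF n]] by auto
    moreover have "V m m" using col[OF m diag[OF m]] by simp
    ultimately show ?thesis using row[OF m] by blast
  qed
  show ?thesis
  proof (rule lepoll_image)
    show "dft (\<lambda>e. ?I (e 0))" by (intro dI df)
    show "elts (vprod omega omega) \<subseteq> ?I ` elts omega"
    proof
      fix p assume "p \<in> elts (vprod omega omega)"
      then obtain m n where p: "p = pair m n" "m \<in> elts omega" "n \<in> elts omega" by (auto simp: elts_vprod)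
      from all[OF p(2,3)] obtain k where "k \<in> elts omega" "?I k = pair m n" unfolding V_def by blast
      then show "p \<in> ?I ` elts omega" using p by (metis image_eqI)
    qed
  qed
qed

section \<open>Countable sets and the first uncountable cardinal\<close>

lemma Cantor_omega:
  assumes "elts p = {y. elts y \<subseteq> elts omega}"
  shows "\<not> lepoll p omega"
proof
  assume "lepoll p omega"
  then obtain f where f: "inj_on (vapp f) (elts p)" "vapp f ` elts p \<subseteq> elts omega" unfolding lepoll_def by blast
  \<comment> \<open>Cantor's diagonal set along the injection: the numbers that code a set omitting
    them.\<close>
  let ?D = "{n \<in> elts omega. \<exists>s\<in>elts p. vapp f s = n \<and> n \<notin> elts s}"
  have "is_set ?D" by (rule is_set_Collect) (intro df)
  then obtain d where d: "elts d = ?D" unfolding is_set_def by blast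
  have dp: "d \<in> elts p" using assms d by auto
  have w: "vapp f d \<in> elts omega" using f(2) dp by blast
  have "vapp f d \<in> elts d \<longleftrightarrow> (\<exists>s\<in>elts p. vapp f s = vapp f d \<and> vapp f d \<notin> elts s)" using w by (simp add: d)
  also have "\<dots> \<longleftrightarrow> vapp f d \<notin> elts d" using f(1) dp by (metis inj_onD)
  finally show False by blast
qed

lemma cardinal_vcard: "cardinal (vcard x)"
  unfolding cardinal_def
proof (intro conjI ballI notI)
  fix a assume a: "a \<in> elts (vcard x)" "eqpoll a (vcard x)"
  have "ord_le (vcard x) a"
    using a ordinal_mem[OF ordinal_vcard] eqpoll_trans[OF _ vcard_eqpoll] by (intro vcard_le) blast+
  then show False using a(1) mem_asym mem_irrefl by (auto simp: ord_le_iff)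
qed simp

lemma dfp_cardinal [df]: "dft t \<Longrightarrow> dfp (\<lambda>e. cardinal (t e))"
  unfolding cardinal_def by (rule dfp_subst1[of "\<lambda>k. ordinal k \<and> (\<forall>a\<in>elts k. \<not> eqpoll a k)"]) (intro df)+

text \<open>The \<open>THE\<close> in \<open>aleph1\<close> has a value because some cardinal lies
  above \<open>omega\<close>, namely that of the power set of \<open>omega\<close>.\<close>

lemma
  shows ordinal_aleph1 [simp]: "ordinal aleph1" and omega_in_aleph1: "omega \<in> elts aleph1"
    and aleph1_le: "\<And>a. cardinal a \<Longrightarrow> omega \<in> elts a \<Longrightarrow> ord_le aleph1 a"
proof -
  obtain p where p: "elts p = {y. elts y \<subseteq> elts omega}" using power_set by blast
  have "\<not> ord_le (vcard p) omega"
  proof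
    assume "ord_le (vcard p) omega"
    then have "lepoll (vcard p) omega" by (intro lepoll_subset) (simp add: ord_le_iff_subset)
    then show False using Cantor_omega[OF p] lepoll_vcard lepoll_trans by blast
  qed
  then have P: "cardinal (vcard p) \<and> mem omega (vcard p)"
    using ord_le_linear[of "vcard p" omega] cardinal_vcard by (simp add: elts_def)
  have d: "dfp (\<lambda>e. cardinal (e 0) \<and> mem omega (e 0))" by (intro df)
  note l = least_ord[OF d ordinal_vcard P, folded aleph1_def]
  show "ordinal aleph1" "omega \<in> elts aleph1" using l by (auto simp: elts_def)
  show "ord_le aleph1 a" if "cardinal a" "omega \<in> elts a" for a
    using l(3)[of a] that by (simp add: elts_def cardinal_def)
qed

abbreviation ctble :: "'v \<Rightarrow> bool" where
  "ctble x \<equiv> lepoll x omega"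

lemma dfp_lepoll [df]: "dft s \<Longrightarrow> dft t \<Longrightarrow> dfp (\<lambda>e. lepoll (s e) (t e))"
proof -
  assume *: "dft s" "dft t"
  have "lepoll x y \<longleftrightarrow> (\<exists>f. (\<forall>u\<in>elts x. vapp f u \<in> elts y \<and> (\<forall>v\<in>elts x. vapp f u = vapp f v \<longrightarrow> u = v)))" for x y
    unfolding lepoll_def inj_on_def image_subset_iff by blast
  then show ?thesis
    by (simp only:) (rule dfp_subst2[of "\<lambda>x y. \<exists>f. (\<forall>u\<in>elts x. vapp f u \<in> elts y \<and>
      (\<forall>v\<in>elts x. vapp f u = vapp f v \<longrightarrow> u = v))", OF _ *], intro df)
qed

lemma vcard_le_omega: "ctble x \<Longrightarrow> ord_le (vcard x) omega"
  using ord_le_trans[OF ordinal_omega vcard_mono vcard_ordinal_le] by simp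

lemma vcard_in_aleph1: "mem (vcard x) aleph1 \<longleftrightarrow> ctble x"
proof
  assume "mem (vcard x) aleph1"
  then have "vcard x \<in> elts aleph1" by (simp add: elts_def)
  then have "omega \<notin> elts (vcard x)"
    using aleph1_le[OF cardinal_vcard, of x] mem_asym[of "vcard x" aleph1] mem_irrefl[of aleph1]
    by (auto simp: ord_le_iff)
  then have "lepoll (vcard x) omega"
    using ord_le_linear[of "vcard x" omega] by (intro lepoll_subset) (simp add: ord_le_iff_subset)
  then show "ctble x" using lepoll_vcard lepoll_trans by blast
next
  assume "ctble x"
  then show "mem (vcard x) aleph1"
    using ord_le_mem_trans[OF ordinal_aleph1 vcard_le_omega omega_in_aleph1] by (simp add: elts_def)
qed

lemma lepoll_card_aleph0: "lepoll x (card_aleph0 x)"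
proof -
  have "lepoll (vcard x) (disj_sum (vcard x) omega)"
    by (rule lepollI[of "pair vempty"]) (intro df, auto simp: inj_on_def elts_disj_sum)
  then show ?thesis unfolding card_aleph0_def card_add_def
    using lepoll_vcard lepoll_trans by blast
qed

text \<open>The tags of the disjoint sum are 0 and 1, so a sum of two subsets of
  \<open>omega\<close> lies inside omega x omega.\<close>

lemma card_aleph0_ctble:
  assumes "ctble x" shows "card_aleph0 x = vcard omega"
proof -
  have 1: "elts (vcard x) \<subseteq> elts omega" using vcard_le_omega[OF assms] by (simp add: ord_le_iff_subset)
  have "elts (disj_sum (vcard x) omega) \<subseteq> elts (vprod omega omega)"
    using 1 vsucc_in_omega[OF vempty_in_omega] by (auto simp: elts_disj_sum)
  then have "ctble (disj_sum (vcard x) omega)" using omega_times_omega lepoll_subset lepoll_trans by blast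
  moreover have "lepoll omega (disj_sum (vcard x) omega)"
    by (rule lepollI[of "pair (vsucc vempty)"]) (intro df, auto simp: inj_on_def elts_disj_sum)
  ultimately show ?thesis unfolding card_aleph0_def card_add_def by (rule lepoll_antisym_vcard)
qed

text \<open>Through this the equations between \<open>card_aleph0\<close> values in (c) and in
  \<open>cute\<close> transfer countability from one set to another.\<close>

lemma ctble_iff_card_aleph0: "card_aleph0 x = vcard omega \<longleftrightarrow> ctble x"
  using card_aleph0_ctble lepoll_card_aleph0 lepoll_vcard lepoll_trans by metis

text \<open>(wf) always allows \<open>vempty\<close> as A; with that choice every countable set
  meets its cardinality bound.\<close>

lemma ctble_le_card_aleph0: "ctble x \<Longrightarrow> ord_le (vcard x) (card_aleph0 (vinter vempty y))"
proof -
  assume x: "ctble x"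
  have "ctble (vinter vempty y)" by (rule lepoll_subset) simp
  then show ?thesis using vcard_mono[OF x] by (simp add: card_aleph0_ctble)
qed

text \<open>The reverse bound: for countable A, (wf) asks only about countable subsets.\<close>

lemma ctble_of_le_card_aleph0:
  assumes "ctble y" "ord_le (vcard x) (card_aleph0 y)"
  shows "ctble x"
proof -
  have "elts (vcard x) \<subseteq> elts (vcard omega)"
    using assms by (simp add: card_aleph0_ctble ord_le_iff_subset)
  then show ?thesis using lepoll_subset lepoll_vcard lepoll_trans by meson
qed

lemma ctble_subset: "elts x \<subseteq> elts y \<Longrightarrow> ctble y \<Longrightarrow> ctble x"
  using lepoll_subset lepoll_trans by blast

section \<open>Splitting an infinite cardinal into countably infinite pieces\<close>

text \<open>Hilbert's hotel: if \<open>l\<close> were \<open>vsucc b\<close>, sending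
  \<open>b\<close> to 0 and shifting \<open>omega\<close> by one would inject \<open>l\<close> into
  its element \<open>b\<close>.\<close>

lemma cardinal_limit:
  assumes l: "cardinal l" "\<not> mem l omega" and b: "b \<in> elts l"
  shows "vsucc b \<in> elts l"
proof (rule ccontr)
  assume "vsucc b \<notin> elts l"
  have ol: "ordinal l" using l by (simp add: cardinal_def)
  then have lb: "l = vsucc b" using ordinal_vsucc_cases[OF ol b] \<open>vsucc b \<notin> elts l\<close> by simp
  have ob: "ordinal b" using ordinal_mem[OF ol b] .
  have wb: "elts omega \<subseteq> elts b"
  proof -
    have "b \<notin> elts omega" using l(2) vsucc_in_omega lb by (auto simp: elts_def)
    then show ?thesis using ordinal_linear[OF ob ordinal_omega] ordinal_mem_subset[OF ob] by auto
  qed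
  define F where "F x = (if x = b then vempty else if x \<in> elts omega then vsucc x else x)" for x
  have "lepoll l b"
  proof (rule lepollI)
    show "dft (\<lambda>e. F (e 0))" unfolding F_def by (intro df)
    show "inj_on F (elts l)" unfolding inj_on_def F_def
      using vsucc_in_omega vempty_in_omega by auto
    show "F ` elts l \<subseteq> elts b" using wb vsucc_in_omega vempty_in_omega by (auto simp: F_def lb)
  qed
  then have "eqpoll l b" by (rule eqpoll_of_subset[rotated]) (auto simp: lb)
  then show False using l(1) b eqpoll_sym unfolding cardinal_def by blast
qed

definition limit_or_zero :: "'v \<Rightarrow> bool" where
  "limit_or_zero d \<longleftrightarrow> ordinal d \<and> (\<forall>b\<in>elts d. vsucc b \<in> elts d)"

abbreviation ord_plus :: "'v \<Rightarrow> 'v \<Rightarrow> 'v" where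
  "ord_plus \<equiv> viter vsucc"

lemma dfp_limit_or_zero [df]: "dft t \<Longrightarrow> dfp (\<lambda>e. limit_or_zero (t e))"
  unfolding limit_or_zero_def
  by (rule dfp_subst1[of "\<lambda>d. ordinal d \<and> (\<forall>b\<in>elts d. vsucc b \<in> elts d)"]) (intro df)+

lemma dft_vsucc0: "dft (\<lambda>e. vsucc (e 0))" by (intro df)

lemmas ord_plus_simps [simp] = viter_0[OF dft_vsucc0] viter_vsucc[OF dft_vsucc0]
lemmas dft_ord_plus [df] = dft_viter[OF dft_vsucc0]

lemma ord_plus_less_limit:
  assumes "limit_or_zero l" "d \<in> elts l" "n \<in> elts omega"
  shows "ord_plus d n \<in> elts l"
  by (rule omega_induct[OF _ assms(3)]) (intro df, use assms in \<open>auto simp: limit_or_zero_def\<close>)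



lemma ord_plus_ge:
  assumes "n \<in> elts omega"
  shows "elts d \<subseteq> elts (ord_plus d n)"
  by (rule omega_induct[OF _ assms]) (intro df, auto)

lemma ord_plus_strict_mono:
  assumes "n \<in> elts omega" "m \<in> elts n"
  shows "ord_plus d m \<in> elts (ord_plus d n)"
proof -
  have "\<forall>m\<in>elts n. ord_plus d m \<in> elts (ord_plus d n)"
    by (rule omega_induct[OF _ assms(1)]) (intro df, auto)
  then show ?thesis using assms(2) by blast
qed

text \<open>If one limit part were smaller, its sum with a natural number would stay below the other
  limit part. So the limit parts agree, and strict monotonicity settles the rest.\<close>

lemma ord_plus_inject:
  assumes d: "limit_or_zero d" "limit_or_zero d'" and n: "n \<in> elts omega" "n' \<in> elts omega"
    and eq: "ord_plus d n = ord_plus d' n'"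
  shows "d = d' \<and> n = n'"
proof -
  have *: "d \<notin> elts d'" if "limit_or_zero d'" "n \<in> elts omega" "n' \<in> elts omega"
    "ord_plus d n = ord_plus d' n'" for d d' n n'
  proof
    assume "d \<in> elts d'"
    then have "ord_plus d n \<in> elts d'" using ord_plus_less_limit that by blast
    then show False using ord_plus_ge[OF that(3), of d'] that(4) mem_irrefl by auto
  qed
  have "d = d'" using *[OF d(2) n eq] *[OF d(1) n(2,1) eq[symmetric]] ordinal_linear[of d d'] d
    by (auto simp: limit_or_zero_def)
  moreover have "n = n'"
    using ordinal_linear[OF ordinal_nat ordinal_nat, OF n] ord_plus_strict_mono[OF n(1), of n' d]
      ord_plus_strict_mono[OF n(2), of n d] eq \<open>d = d'\<close> by auto
  ultimately show ?thesis by blast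
qed

lemma ord_plus_exists:
  assumes "ordinal a"
  shows "\<exists>d\<in>elts (vsucc a). \<exists>n\<in>elts omega. limit_or_zero d \<and> a = ord_plus d n"
proof (rule ordinal_induct[OF _ assms])
  show "dfp (\<lambda>e. \<exists>d\<in>elts (vsucc (e 0)). \<exists>n\<in>elts omega. limit_or_zero d \<and> (e 0) = ord_plus d n)" by (intro df)
  fix a assume a: "ordinal a"
    and IH: "\<And>b. b \<in> elts a \<Longrightarrow> \<exists>d\<in>elts (vsucc b). \<exists>n\<in>elts omega. limit_or_zero d \<and> b = ord_plus d n"
  show "\<exists>d\<in>elts (vsucc a). \<exists>n\<in>elts omega. limit_or_zero d \<and> a = ord_plus d n"
  proof (cases "limit_or_zero a")
    case True
    then show ?thesis by (intro bexI[of _ a] bexI[of _ vempty]) auto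
  next
    case False
    then obtain b where b: "b \<in> elts a" "vsucc b \<notin> elts a" using a by (auto simp: limit_or_zero_def)
    then have ab: "a = vsucc b" using ordinal_vsucc_cases[OF a b(1)] by simp
    from IH[OF b(1)] obtain d n where "d \<in> elts (vsucc b)" "n \<in> elts omega" "limit_or_zero d" "b = ord_plus d n" by blast
    then show ?thesis using ab vsucc_in_omega[of n]
      by (intro bexI[of _ d] bexI[of _ "vsucc n"]) auto
  qed
qed

text \<open>With the first coordinate written as \<open>d + n\<close>, the pair
  \<open>(d + n, m)\<close> goes to \<open>d + f(n, m)\<close>: each block of type omega absorbs its
  product with \<open>omega\<close>, and \<open>l\<close>, being a limit, contains every block that
  starts below it.\<close>

lemma infinite_cardinal_times_omega:
  assumes l: "cardinal l" "\<not> mem l omega"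
  shows "lepoll (vprod l omega) l"
proof -
  obtain f where f: "inj_on (vapp f) (elts (vprod omega omega))" "vapp f ` elts (vprod omega omega) \<subseteq> elts omega"
    using omega_times_omega unfolding lepoll_def by blast
  have fw: "vapp f (pair m n) \<in> elts omega" if "m \<in> elts omega" "n \<in> elts omega" for m n
    using f(2) that by (auto simp: image_subset_iff)
  have ll: "limit_or_zero l" using cardinal_limit[OF l] l(1) by (auto simp: limit_or_zero_def cardinal_def)
  define P where "P p q \<longleftrightarrow> (\<exists>d\<in>elts l. \<exists>n\<in>elts omega. \<exists>m\<in>elts omega. limit_or_zero d \<and>
      p = pair (ord_plus d n) m \<and> q = ord_plus d (vapp f (pair n m)))" for p q
  define F where "F p = vthe (P p)" for p
  have dec: "\<exists>d n m. d \<in> elts l \<and> n \<in> elts omega \<and> m \<in> elts omega \<and> limit_or_zero d \<and> p = pair (ord_plus d n) m"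
    if p: "p \<in> elts (vprod l omega)" for p
  proof -
    obtain a m where a: "p = pair a m" "a \<in> elts l" "m \<in> elts omega" using p by (auto simp: elts_vprod)
    have "ordinal a" using ordinal_mem a(2) ll by (auto simp: limit_or_zero_def)
    from ord_plus_exists[OF this] obtain d n where d: "d \<in> elts (vsucc a)" "n \<in> elts omega" "limit_or_zero d"
      "a = ord_plus d n" by blast
    have "d \<in> elts l" using d(1) a(2) ll ordinal_trans[of l a d] by (auto simp: limit_or_zero_def)
    then show ?thesis using a d by blast
  qed
  have F: "F (pair (ord_plus d n) m) = ord_plus d (vapp f (pair n m))"
    if "d \<in> elts l" "n \<in> elts omega" "m \<in> elts omega" "limit_or_zero d" for d n m
    unfolding F_def
  proof (rule vthe_eq)
    show "P (pair (ord_plus d n) m) (ord_plus d (vapp f (pair n m)))" unfolding P_def using that by blast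
    fix z assume "P (pair (ord_plus d n) m) z"
    then obtain d' n' where "limit_or_zero d'" "n' \<in> elts omega" "ord_plus d n = ord_plus d' n'"
       "z = ord_plus d' (vapp f (pair n' m))" unfolding P_def by auto
    then show "z = ord_plus d (vapp f (pair n m))" using ord_plus_inject[of d d' n n'] that by auto
  qed
  show ?thesis
  proof (rule lepollI)
    show "dft (\<lambda>e. F (e 0))" unfolding F_def P_def by (intro df)
    show "inj_on F (elts (vprod l omega))"
    proof (rule inj_onI)
      fix p p' assume "p \<in> elts (vprod l omega)" "p' \<in> elts (vprod l omega)" and eq: "F p = F p'"
      then obtain d n m d' n' m' where
        p: "d \<in> elts l" "n \<in> elts omega" "m \<in> elts omega" "limit_or_zero d" "p = pair (ord_plus d n) m"
        and p': "d' \<in> elts l" "n' \<in> elts omega" "m' \<in> elts omega" "limit_or_zero d'" "p' = pair (ord_plus d' n') m'"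
        using dec[of p] dec[of p'] by blast
      have "d = d' \<and> vapp f (pair n m) = vapp f (pair n' m')"
        using eq p p' fw by (intro ord_plus_inject) (auto simp: F)
      then show "p = p'" using inj_onD[OF f(1), of "pair n m" "pair n' m'"] p p' by auto
    qed
    show "F ` elts (vprod l omega) \<subseteq> elts l"
    proof
      fix q assume "q \<in> F ` elts (vprod l omega)"
      then obtain p where p: "p \<in> elts (vprod l omega)" "q = F p" by blast
      from dec[OF p(1)] show "q \<in> elts l" using p(2) F fw ord_plus_less_limit[OF ll] by auto
    qed
  qed
qed

section \<open>Covering families and cofibrant objects\<close>

lemma vcard_in_vtwo: "mem (vcard f) vtwo \<longleftrightarrow> f = vempty \<or> (\<exists>x. elts f = {x})"
proof -
  have two: "elts vtwo = {vempty, vsucc vempty}" by (auto simp: vtwo_def)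
  have "f = vempty \<or> (\<exists>x. elts f = {x})" if "vcard f \<in> elts vtwo"
  proof -
    obtain g where g: "bij_betw (vapp g) (elts (vcard f)) (elts f)" by (rule eqpollE[OF vcard_eqpoll])
    then have "elts f = vapp g ` elts (vcard f)" by (simp add: bij_betw_def)
    moreover have "elts (vcard f) = {} \<or> elts (vcard f) = {vempty}" using that two by auto
    ultimately show ?thesis by (metis elts_eq_empty image_empty image_insert)
  qed
  moreover have "vcard f \<in> elts vtwo" if "f = vempty \<or> (\<exists>x. elts f = {x})"
  proof -
    have "lepoll f (vsucc vempty)"
      by (rule lepollI[of "\<lambda>_. vempty"]) (intro df, use that in \<open>auto simp: inj_on_def\<close>)
    then have "ord_le (vcard f) (vsucc vempty)"
      using ord_le_trans[OF _ vcard_mono vcard_ordinal_le] ordinal_vsucc by simp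
    then show ?thesis by (auto simp: ord_le_iff two)
  qed
  ultimately show ?thesis by (auto simp: elts_def)
qed

text \<open>Fewer than two members means none or one. The empty union covers just the empty set,
  hence the disjunct \<open>y = vempty\<close>, which matches the added \<open>vempty\<close> in the
  labels.\<close>

lemma is_cover_iff: "is_cover l aleph1 aleph1 vtwo X \<longleftrightarrow>
    (\<forall>x\<in>elts X. elts x \<subseteq> elts l \<and> ctble x) \<and>
    (\<forall>y. elts y \<subseteq> elts l \<and> ctble y \<longrightarrow> y = vempty \<or> (\<exists>x\<in>elts X. elts y \<subseteq> elts x))"
proof -
  have "(\<exists>F. elts F \<subseteq> elts X \<and> mem (vcard F) vtwo \<and> elts y \<subseteq> (\<Union>x\<in>elts F. elts x)) \<longleftrightarrow>
      y = vempty \<or> (\<exists>x\<in>elts X. elts y \<subseteq> elts x)" (is "?A \<longleftrightarrow> ?B") for y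
  proof
    assume ?A
    then obtain F where F: "elts F \<subseteq> elts X" "F = vempty \<or> (\<exists>x. elts F = {x})"
      "elts y \<subseteq> (\<Union>x\<in>elts F. elts x)" unfolding vcard_in_vtwo by blast
    from F(2) show ?B
    proof
      assume "F = vempty"
      then have "elts y = {}" using F(3) by simp
      then show ?B by simp
    next
      assume "\<exists>x. elts F = {x}"
      then show ?B using F(1,3) by auto
    qed
  next
    assume B: ?B
    show ?A
    proof (cases "y = vempty")
      case True
      then show ?thesis by (intro exI[of _ vempty]) (simp add: vcard_in_vtwo)
    next
      case False
      then obtain x where "x \<in> elts X" "elts y \<subseteq> elts x" using B by blast
      then show ?thesis by (intro exI[of _ "upair x x"]) (simp add: vcard_in_vtwo)
    qed
  qed
  then show ?thesis unfolding is_cover_def vcard_in_aleph1 by simp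
qed

lemma
  shows ex_min_cover: "\<exists>X. is_cover l aleph1 aleph1 vtwo X \<and> cov l aleph1 aleph1 vtwo = vcard X"
    and cov_le: "\<And>X. is_cover l aleph1 aleph1 vtwo X \<Longrightarrow> ord_le (cov l aleph1 aleph1 vtwo) (vcard X)"
proof -
  obtain pl where pl: "elts pl = {y. elts y \<subseteq> elts l}" using power_set by blast
  have "is_set {y \<in> elts pl. ctble y}" by (rule is_set_Collect) (intro df)
  then obtain X where X: "elts X = {y \<in> elts pl. ctble y}" unfolding is_set_def by blast
  let ?P = "\<lambda>a. \<exists>X. is_cover l aleph1 aleph1 vtwo X \<and> a = vcard X"
  have "is_cover l aleph1 aleph1 vtwo X" unfolding is_cover_iff by (auto simp: X pl)
  then have ex: "?P (vcard X)" by blast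
  have d: "dfp (\<lambda>e. ?P (e 0))" unfolding is_cover_iff by (intro df)
  note l = least_ord[OF d ordinal_vcard ex, folded cov_def]
  show "?P (cov l aleph1 aleph1 vtwo)" by (rule l(2))
  show "ord_le (cov l aleph1 aleph1 vtwo) (vcard X)" if "is_cover l aleph1 aleph1 vtwo X" for X
    by (rule l(3)) (use that in auto)
qed

lemma cofibrantI:
  assumes "\<And>y. y \<in> Y \<Longrightarrow> ctble y"
  shows "cofibrant Y"
proof -
  have "\<exists>A\<in>{} \<union> {vempty}. \<exists>n\<in>elts omega. \<exists>s. is_fun_on s (vsucc n) \<and>
      (\<forall>i\<in>elts (vsucc n). \<exists>b\<in>Y. elts (app s i) \<subseteq> elts b) \<and>
      card_aleph0 (vinter A (app s vempty)) = card_aleph0 (app s vempty) \<and>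
      (\<forall>i\<in>elts n. card_aleph0 (vinter (app s i) (app s (vsucc i))) = card_aleph0 (app s (vsucc i))) \<and>
      app s n = B" if B: "b \<in> Y" "elts B \<subseteq> elts b" for B b
  proof -
    \<comment> \<open>A one-term sequence suffices: \<open>n\<close> is 0, its only entry is
      \<open>B\<close>, and A is \<open>vempty\<close>.\<close>
    have "dft (\<lambda>e. B)" by (intro df)
    from ex_vapp[OF this, of "vsucc vempty"] obtain s where
      s: "is_fun_on s (vsucc vempty)" "app s vempty = B" by (metis elts_vsucc insertI1)
    have "ctble B" using ctble_subset[OF B(2)] assms[OF B(1)] by blast
    moreover have "ctble (vinter vempty B)" by (rule lepoll_subset) simp
    ultimately show ?thesis using s B
      by (intro bexI[of _ vempty] exI[of _ s]) (auto simp: card_aleph0_ctble)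
  qed
  then show ?thesis unfolding cofibrant_def arrow_c_def arrow_def by blast
qed

text \<open>The chain starts from \<open>vempty\<close>, and each equation passes countability on to
  the next entry. The induction is guarded by membership in \<open>vsucc n\<close>, the domain of
  \<open>s\<close>.\<close>

lemma cofibrantD:
  assumes "cofibrant Y" "y \<in> Y"
  shows "ctble y"
proof -
  from assms obtain n s where n: "n \<in> elts omega" and s: "is_fun_on s (vsucc n)"
    and s0: "card_aleph0 (vinter vempty (app s vempty)) = card_aleph0 (app s vempty)"
    and ss: "\<And>i. i \<in> elts n \<Longrightarrow>
        card_aleph0 (vinter (app s i) (app s (vsucc i))) = card_aleph0 (app s (vsucc i))"
    and sn: "app s n = y"
    unfolding cofibrant_def arrow_c_def by blast
  note on = ordinal_nat[OF n]
  have app: "app s i = vapp s i" if "i \<in> elts (vsucc n)" for i using app_eq_vapp[OF s that] .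
  have "n \<in> elts (vsucc n) \<longrightarrow> ctble (vapp s n)"
  proof (rule omega_induct[OF _ n, where P = "\<lambda>i. i \<in> elts (vsucc n) \<longrightarrow> ctble (vapp s i)"])
    show "dfp (\<lambda>e. e 0 \<in> elts (vsucc n) \<longrightarrow> ctble (vapp s (e 0)))" by (intro df)
    have "ctble (vinter vempty (app s vempty))" by (rule lepoll_subset) simp
    then have "ctble (app s vempty)" using s0 by (metis ctble_iff_card_aleph0)
    then show "vempty \<in> elts (vsucc n) \<longrightarrow> ctble (vapp s vempty)" using app by metis
    fix i assume IH: "i \<in> elts (vsucc n) \<longrightarrow> ctble (vapp s i)"
    show "vsucc i \<in> elts (vsucc n) \<longrightarrow> ctble (vapp s (vsucc i))"
    proof
      assume si: "vsucc i \<in> elts (vsucc n)"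
      then have i: "i \<in> elts n" using vsucc_mem_iff[OF on] by blast
      then have i': "i \<in> elts (vsucc n)" by simp
      have "ctble (vinter (app s i) (app s (vsucc i)))"
        by (rule ctble_subset[of _ "vapp s i"]) (use IH i' app[OF i'] in auto)
      then have "ctble (app s (vsucc i))" using ss[OF i] by (metis ctble_iff_card_aleph0)
      then show "ctble (vapp s (vsucc i))" using app[OF si] by simp
    qed
  qed
  then show ?thesis using sn app[of n] by simp
qed

lemma arrow_wf_ctble:
  assumes "arrow_wf W X" "B \<in> X" "elts B' \<subseteq> elts B" "ctble B'"
  shows "\<exists>A\<in>W \<union> {vempty}. elts B' \<subseteq> elts A"
  using assms(1-3) ctble_le_card_aleph0[OF assms(4), of B] unfolding arrow_wf_def by blast

text \<open>The cardinality equation makes \<open>B\<close> countable, so (wf) applied to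
  \<open>B\<close> as its own subset puts it inside one element of \<open>W\<close>, or else
  \<open>B\<close> is empty.\<close>

lemma cute_ctble:
  assumes "\<And>x. x \<in> X \<Longrightarrow> ctble x"
  shows "cute X"
  unfolding cute_def
proof (intro allI ballI impI)
  fix A B W assume *: "elts A \<subseteq> elts B \<and> card_aleph0 A = card_aleph0 B \<and> arrow_wf W {B} \<and> arrow W X \<and> arrow {A} X"
  then obtain x where x: "x \<in> X" "elts A \<subseteq> elts x" by (auto simp: arrow_def)
  have "ctble A" using ctble_subset[OF x(2)] assms[OF x(1)] by blast
  then have "ctble B" using * by (metis ctble_iff_card_aleph0)
  then obtain A' where A': "A' \<in> W \<union> {vempty}" "elts B \<subseteq> elts A'"
    using * arrow_wf_ctble[of W "{B}" B B] by blast
  show "arrow {B} X"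
  proof (cases "A' \<in> W")
    case True
    then obtain x' where "x' \<in> X" "elts A' \<subseteq> elts x'" using * by (auto simp: arrow_def)
    then show ?thesis using A'(2) by (auto simp: arrow_def)
  next
    case False
    then have "elts B = {}" using A' by simp
    then show ?thesis using x(1) by (auto simp: arrow_def)
  qed
qed

text \<open>(wf) on one-point subsets of \<open>B\<close> places every point in some element of
  \<open>W\<close>, hence in \<open>x\<close>.\<close>

lemma cute_singleton: "cute {x}"
  unfolding cute_def
proof (intro allI ballI impI)
  fix A B W assume *: "elts A \<subseteq> elts B \<and> card_aleph0 A = card_aleph0 B \<and> arrow_wf W {B} \<and> arrow W {x} \<and> arrow {A} {x}"
  have "elts B \<subseteq> elts x"
  proof
    fix b assume b: "b \<in> elts B"
    have "ctble (upair b b)"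
      by (rule lepollI[of "\<lambda>_. vempty"]) (intro df, auto)
    then obtain A' where "A' \<in> W \<union> {vempty}" "elts (upair b b) \<subseteq> elts A'"
      using * arrow_wf_ctble[of W "{B}" B "upair b b"] b by auto
    then show "b \<in> elts x" using * by (auto simp: arrow_def)
  qed
  then show "arrow {B} {x}" by (simp add: arrow_def)
qed

lemma singleton_in_Cls: "{x} \<in> Cls"
  using elts_in_Cls[of "upair x x"] by simp

section \<open>The two inequalities\<close>

text \<open>The zigzag runs from \<open>{l}\<close> to itself, back along (w) to the cover, and ends
  there by identities. The object witnessing (w) is the cover itself: the identity carries (wc), and
  the covering property gives (wf).\<close>

lemma cover_in_derived_set:
  assumes "is_cover l aleph1 aleph1 vtwo X"
  shows "elts X \<in> QtNaamen" "arrow_h {l} (elts X)" "cofibrant (elts X)"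
proof -
  have X: "\<And>x. x \<in> elts X \<Longrightarrow> elts x \<subseteq> elts l \<and> ctble x"
    and cov: "\<And>y. elts y \<subseteq> elts l \<Longrightarrow> ctble y \<Longrightarrow> y = vempty \<or> (\<exists>x\<in>elts X. elts y \<subseteq> elts x)"
    using assms unfolding is_cover_iff by auto
  show Q: "elts X \<in> QtNaamen" unfolding QtNaamen_def using elts_in_Cls cute_ctble X by blast
  show "cofibrant (elts X)" using cofibrantI X by blast
  have L: "{l} \<in> QtNaamen" unfolding QtNaamen_def using singleton_in_Cls cute_singleton by blast
  have "arrow_wf (elts X) {l}" unfolding arrow_wf_def
  proof (intro conjI ballI allI impI)
    show "arrow (elts X) {l}" using X by (auto simp: arrow_def)
    fix A B B' assume A: "A \<in> elts X \<union> {vempty}" and B: "B \<in> {l}"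
      and B': "elts B' \<subseteq> elts B \<and> ord_le (vcard B') (card_aleph0 (vinter A B))"
    have "ctble A" using A X lepoll_subset[of vempty omega] by auto
    then have "ctble (vinter A B)" using ctble_subset[of "vinter A B" A] by simp
    then have "ctble B'" using ctble_of_le_card_aleph0 B' by blast
    then show "\<exists>A'\<in>elts X \<union> {vempty}. elts B' \<subseteq> elts A'" using cov[of B'] B B' by auto
  qed
  moreover have "arrow_wc (elts X) (elts X)" unfolding arrow_wc_def
  proof (intro conjI ballI)
    show "arrow (elts X) (elts X)" by (auto simp: arrow_def)
    fix B assume "B \<in> elts X"
    moreover have "vfinite (vdiff B B)"
    proof -
      have "vdiff B B = vempty" by (simp flip: elts_eq_empty)
      then show ?thesis unfolding vfinite_def by (metis eqpoll_refl vempty_in_omega)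
    qed
    ultimately show "\<exists>A\<in>elts X \<union> {vempty}. vfinite (vdiff B A)" by blast
  qed
  ultimately have w: "arrow_w (elts X) {l}" unfolding arrow_w_def using elts_in_Cls by blast
  have h: "arrow_h (elts X) (elts X)"
    by (rule arrow_h.last[OF Q Q Q]) (auto simp: arrow_def)
  show "arrow_h {l} (elts X)"
    by (rule arrow_h.step[OF L L Q _ w h]) (simp add: arrow_def)
qed

section \<open>Lower bound: fibres and almost covering along zigzags\<close>

lemma finite_bounded:
  assumes F: "dft (\<lambda>e. F (e 0))" and n: "n \<in> elts omega" and "\<And>i. i \<in> elts n \<Longrightarrow> F i \<in> elts omega"
  shows "\<exists>m\<in>elts omega. \<forall>i\<in>elts n. F i \<in> elts m"
proof -
  note dF = dft_subst1[OF F]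
  have "(\<forall>i\<in>elts n. F i \<in> elts omega) \<longrightarrow> (\<exists>m\<in>elts omega. \<forall>i\<in>elts n. F i \<in> elts m)"
  proof (rule omega_induct[OF _ n])
    show "dfp (\<lambda>e. (\<forall>i\<in>elts (e 0). F i \<in> elts omega) \<longrightarrow> (\<exists>m\<in>elts omega. \<forall>i\<in>elts (e 0). F i \<in> elts m))"
      by (intro df dF)
    fix n assume IH: "(\<forall>i\<in>elts n. F i \<in> elts omega) \<longrightarrow> (\<exists>m\<in>elts omega. \<forall>i\<in>elts n. F i \<in> elts m)"
    show "(\<forall>i\<in>elts (vsucc n). F i \<in> elts omega) \<longrightarrow> (\<exists>m\<in>elts omega. \<forall>i\<in>elts (vsucc n). F i \<in> elts m)"
    proof
      assume Fw: "\<forall>i\<in>elts (vsucc n). F i \<in> elts omega"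
      then obtain m where m: "m \<in> elts omega" "\<forall>i\<in>elts n. F i \<in> elts m" using IH by auto
      have k: "vsucc (F n) \<in> elts omega" using Fw vsucc_in_omega by simp
      have "elts m \<subseteq> elts (vsucc (F n)) \<or> elts (vsucc (F n)) \<subseteq> elts m"
        using ordinal_linear[OF ordinal_nat[OF m(1)] ordinal_nat[OF k]]
          ordinal_mem_subset[OF ordinal_nat[OF m(1)]] ordinal_mem_subset[OF ordinal_nat[OF k]] by blast
      then show "\<exists>m\<in>elts omega. \<forall>i\<in>elts (vsucc n). F i \<in> elts m"
      proof
        assume "elts m \<subseteq> elts (vsucc (F n))"
        then show ?thesis using m(2) by (intro bexI[OF _ k]) auto
      next
        assume "elts (vsucc (F n)) \<subseteq> elts m"
        then show ?thesis using m(2) by (intro bexI[OF _ m(1)]) auto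
      qed
    qed
  qed (use vempty_in_omega in \<open>simp, blast\<close>)
  then show ?thesis using assms(3) by blast
qed

text \<open>
  Here \<open>f\<close> embeds \<open>l \<times> \<omega>\<close> into \<open>l\<close>.  Fibre-bounded sets replace finite ones: they are trivially closed
  under unions and subsets, and a fibre is never fibre-bounded, which is all that the projection
  to \<open>l\<close> needs.
\<close>

definition fibre_bounded :: "'v \<Rightarrow> 'v \<Rightarrow> 'v set \<Rightarrow> bool" where
  "fibre_bounded f l S \<longleftrightarrow> (\<forall>a\<in>elts l. \<exists>m\<in>elts omega. \<forall>k\<in>elts omega. vapp f (pair a k) \<in> S \<longrightarrow> k \<in> elts m)"

lemma fibre_bounded_subset: "fibre_bounded f l T \<Longrightarrow> S \<subseteq> T \<Longrightarrow> fibre_bounded f l S"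
  unfolding fibre_bounded_def by blast

lemma fibre_bounded_Un:
  assumes "fibre_bounded f l S" "fibre_bounded f l T"
  shows "fibre_bounded f l (S \<union> T)"
  unfolding fibre_bounded_def
proof
  fix a assume a: "a \<in> elts l"
  obtain m where m: "m \<in> elts omega" "\<And>k. k \<in> elts omega \<Longrightarrow> vapp f (pair a k) \<in> S \<Longrightarrow> k \<in> elts m"
    using assms(1) a unfolding fibre_bounded_def by blast
  obtain m' where m': "m' \<in> elts omega" "\<And>k. k \<in> elts omega \<Longrightarrow> vapp f (pair a k) \<in> T \<Longrightarrow> k \<in> elts m'"
    using assms(2) a unfolding fibre_bounded_def by blast
  have "elts m \<subseteq> elts m' \<or> elts m' \<subseteq> elts m"
    using ordinal_linear[OF ordinal_nat[OF m(1)] ordinal_nat[OF m'(1)]]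
      ordinal_mem_subset[OF ordinal_nat[OF m(1)]] ordinal_mem_subset[OF ordinal_nat[OF m'(1)]] by blast
  then show "\<exists>m\<in>elts omega. \<forall>k\<in>elts omega. vapp f (pair a k) \<in> S \<union> T \<longrightarrow> k \<in> elts m"
    using m m' by blast
qed

lemma fibre_bounded_vfinite:
  assumes f: "inj_on (vapp f) (elts (vprod l omega))" and "vfinite s"
  shows "fibre_bounded f l (elts s)"
  unfolding fibre_bounded_def
proof
  fix a assume a: "a \<in> elts l"
  obtain n where n: "n \<in> elts omega" "eqpoll n s" using assms(2) unfolding vfinite_def by blast
  obtain g where g: "bij_betw (vapp g) (elts n) (elts s)" by (rule eqpollE[OF n(2)])
  \<comment> \<open>\<open>F i\<close> is the fibre coordinate of the \<open>i\<close>-th element of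
    \<open>s\<close>, with default \<open>vempty\<close> for elements off the fibre over
    \<open>a\<close>; the default keeps all values in \<open>omega\<close>.\<close>
  define F where "F i = vthe (\<lambda>k. k \<in> elts omega \<and> vapp f (pair a k) = vapp g i)" for i
  have inj: "k = k'" if "k \<in> elts omega" "k' \<in> elts omega" "vapp f (pair a k) = vapp f (pair a k')" for k k'
    using inj_onD[OF f that(3)] that(1,2) a by simp
  have F: "F i = k" if "k \<in> elts omega" "vapp f (pair a k) = vapp g i" for i k
    unfolding F_def using that by (intro vthe_eq) (auto intro: inj)
  have Fw: "F i \<in> elts omega" for i
  proof (cases "\<exists>k\<in>elts omega. vapp f (pair a k) = vapp g i")
    case True
    then show ?thesis using F by auto
  next
    case False
    then have "F i = vempty" unfolding F_def vthe_def by auto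
    then show ?thesis by simp
  qed
  have "dft (\<lambda>e. F (e 0))" unfolding F_def by (intro df)
  from finite_bounded[OF this n(1) Fw] obtain m where m: "m \<in> elts omega" "\<forall>i\<in>elts n. F i \<in> elts m" by blast
  have "k \<in> elts m" if k: "k \<in> elts omega" "vapp f (pair a k) \<in> elts s" for k
  proof -
    obtain i where "i \<in> elts n" "vapp f (pair a k) = vapp g i" using g k(2) unfolding bij_betw_def by (metis imageE)
    then show ?thesis using F[OF k(1)] m(2) by auto
  qed
  then show "\<exists>m\<in>elts omega. \<forall>k\<in>elts omega. vapp f (pair a k) \<in> elts s \<longrightarrow> k \<in> elts m" using m(1) by blast
qed

lemma fibre_bounded_empty: "fibre_bounded f l {}"
  unfolding fibre_bounded_def using vempty_in_omega by blast

text \<open>The invariant carried along a zigzag. As in the labels, \<open>vempty\<close> is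
  adjoined, so that the condition can also hold for the empty object.\<close>

definition almost_covers :: "'v \<Rightarrow> 'v \<Rightarrow> 'v set \<Rightarrow> bool" where
  "almost_covers f l X \<longleftrightarrow> (\<forall>b. elts b \<subseteq> elts l \<and> ctble b \<longrightarrow>
     (\<exists>x\<in>X \<union> {vempty}. fibre_bounded f l (elts b - elts x)))"

lemma almost_covers_arrow:
  assumes "almost_covers f l X" "arrow X Y"
  shows "almost_covers f l Y"
  unfolding almost_covers_def
proof (intro allI impI)
  fix b assume "elts b \<subseteq> elts l \<and> ctble b"
  then obtain x where x: "x \<in> X \<union> {vempty}" "fibre_bounded f l (elts b - elts x)"
    using assms(1) unfolding almost_covers_def by blast
  obtain y where y: "y \<in> Y \<union> {vempty}" "elts x \<subseteq> elts y"
    using x(1) assms(2) unfolding arrow_def by auto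
  have "fibre_bounded f l (elts b - elts y)" by (rule fibre_bounded_subset[OF x(2)]) (use y in blast)
  then show "\<exists>x\<in>Y \<union> {vempty}. fibre_bounded f l (elts b - elts x)" using y by blast
qed

text \<open>(wf) puts the countable set \<open>b\<close> intersected with \<open>x\<close> inside
  some \<open>z\<close>, and (wc) puts \<open>z\<close> inside some \<open>y\<close> up to finitely
  many points; so \<open>b - y\<close> is contained in the union of \<open>b - x\<close> and
  \<open>z - y\<close>.\<close>

lemma almost_covers_arrow_w:
  assumes inj: "inj_on (vapp f) (elts (vprod l omega))"
    and X: "almost_covers f l X" and w: "arrow_w Y X"
  shows "almost_covers f l Y"
  unfolding almost_covers_def
proof (intro allI impI)
  fix b assume b: "elts b \<subseteq> elts l \<and> ctble b"
  obtain Z where wc: "arrow_wc Y Z" and wf: "arrow_wf Z X" using w unfolding arrow_w_def by blast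
  obtain x where x: "x \<in> X \<union> {vempty}" "fibre_bounded f l (elts b - elts x)"
    using X b unfolding almost_covers_def by blast
  have "\<exists>z\<in>Z \<union> {vempty}. elts b \<inter> elts x \<subseteq> elts z"
  proof (cases "x \<in> X")
    case True
    have "ctble (vinter b x)" using ctble_subset[of "vinter b x" b] b by simp
    then show ?thesis using arrow_wf_ctble[OF wf True, of "vinter b x"] by simp
  next
    case False
    then show ?thesis using x(1) by auto
  qed
  then obtain z where z: "z \<in> Z \<union> {vempty}" "elts b \<inter> elts x \<subseteq> elts z" by blast
  obtain y where y: "y \<in> Y \<union> {vempty}" "fibre_bounded f l (elts z - elts y)"
  proof (cases "z \<in> Z")
    case True
    then obtain y where "y \<in> Y \<union> {vempty}" "vfinite (vdiff z y)" using wc unfolding arrow_wc_def by blast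
    then show ?thesis using fibre_bounded_vfinite[OF inj, of "vdiff z y"] that by simp
  next
    case False
    then show ?thesis using that[of vempty] z(1) fibre_bounded_empty by simp
  qed
  have "fibre_bounded f l (elts b - elts y)"
    by (rule fibre_bounded_subset[OF fibre_bounded_Un[OF x(2) y(2)]]) (use z(2) in blast)
  then show "\<exists>x\<in>Y \<union> {vempty}. fibre_bounded f l (elts b - elts x)" using y(1) by blast
qed

lemma almost_covers_arrow_h:
  assumes inj: "inj_on (vapp f) (elts (vprod l omega))"
    and "arrow_h X Y" "almost_covers f l X"
  shows "almost_covers f l Y"
  using assms(2,3)
proof (induction rule: arrow_h.induct)
  case (last X X1 Y)
  then show ?case using almost_covers_arrow by blast
next
  case (step X X1 X2 Y)
  then show ?case using almost_covers_arrow almost_covers_arrow_w[OF inj] by blast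
qed

lemma cov_le_derived_set:
  assumes l: "lepoll (vprod l omega) l" and h: "arrow_h {l} (elts Y)" and c: "cofibrant (elts Y)"
  shows "ord_le (cov l aleph1 aleph1 vtwo) (vcard Y)"
proof -
  obtain f where f: "inj_on (vapp f) (elts (vprod l omega))" "vapp f ` elts (vprod l omega) \<subseteq> elts l"
    using l unfolding lepoll_def by blast
  have "almost_covers f l {l}" unfolding almost_covers_def
  proof (intro allI impI bexI[of _ l])
    fix b assume "elts b \<subseteq> elts l \<and> ctble b"
    then show "fibre_bounded f l (elts b - elts l)" by (intro fibre_bounded_subset[OF fibre_bounded_empty]) blast
  qed simp
  then have Y: "almost_covers f l (elts Y)" using almost_covers_arrow_h[OF f(1) h] by blast
  define G where "G y = vthe (\<lambda>z. \<forall>a. a \<in> elts z \<longleftrightarrow> a \<in> elts l \<and> (\<exists>k\<in>elts omega. vapp f (pair a k) \<in> elts y))" for y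
  have G: "elts (G y) = {a \<in> elts l. \<exists>k\<in>elts omega. vapp f (pair a k) \<in> elts y}" (is "_ = ?S y") for y
  proof -
    have "is_set (?S y)" by (rule is_set_Collect) (intro df)
    then obtain z where z: "elts z = ?S y" unfolding is_set_def by blast
    have "G y = z" unfolding G_def
      by (rule vthe_eq) (simp_all add: z set_eq_iff flip: elts_inject)
    then show ?thesis using z by simp
  qed
  have dG: "dft (\<lambda>e. G (e 0))" unfolding G_def by (intro df)
  obtain X where X: "elts X = G ` elts Y" using is_set_image[OF dG] unfolding is_set_def by metis
  have "is_cover l aleph1 aleph1 vtwo X" unfolding is_cover_iff
  proof (intro conjI ballI allI impI)
    fix x assume "x \<in> elts X"
    then obtain y where y: "y \<in> elts Y" "x = G y" by (auto simp: X)
    show "elts x \<subseteq> elts l" by (auto simp: y G)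
    \<comment> \<open>\<open>H\<close> undoes the embedding and keeps the first coordinate; it maps
      \<open>y\<close> onto a superset of its projection \<open>x\<close>, so \<open>x\<close>
      inherits countability.\<close>
    define H where "H u = vthe (\<lambda>a. a \<in> elts l \<and> (\<exists>k\<in>elts omega. vapp f (pair a k) = u))" for u
    have H: "H (vapp f (pair a k)) = a" if "a \<in> elts l" "k \<in> elts omega" for a k
      unfolding H_def
    proof (rule vthe_eq)
      fix a' assume "a' \<in> elts l \<and> (\<exists>k'\<in>elts omega. vapp f (pair a' k') = vapp f (pair a k))"
      then obtain k' where k': "a' \<in> elts l" "k' \<in> elts omega" "vapp f (pair a' k') = vapp f (pair a k)" by blast
      show "a' = a" using inj_onD[OF f(1) k'(3)] k'(1,2) that by simp
    qed (use that in blast)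
    have "lepoll x y"
    proof (rule lepoll_image)
      show "dft (\<lambda>e. H (e 0))" unfolding H_def by (intro df)
      show "elts x \<subseteq> H ` elts y"
      proof
        fix a assume "a \<in> elts x"
        then obtain k where "a \<in> elts l" "k \<in> elts omega" "vapp f (pair a k) \<in> elts y" by (auto simp: y G)
        then show "a \<in> H ` elts y" using H by (metis image_eqI)
      qed
    qed
    then show "ctble x" using cofibrantD[OF c y(1)] lepoll_trans by blast
  next
    fix b assume b: "elts b \<subseteq> elts l \<and> ctble b"
    have "is_set (vapp f ` elts (vprod b omega))" by (rule is_set_image) (intro df)
    then obtain b' where b': "elts b' = vapp f ` elts (vprod b omega)" unfolding is_set_def by blast
    have sub: "elts (vprod b omega) \<subseteq> elts (vprod l omega)" using b by (auto simp: elts_vprod)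
    have "lepoll b' (vprod b omega)" by (rule lepoll_image[of "vapp f"]) (intro df, simp add: b')
    moreover have "lepoll (vprod b omega) (vprod omega omega)" using lepoll_vprod_mono b by simp
    ultimately have "ctble b'" using omega_times_omega lepoll_trans by blast
    moreover have "elts b' \<subseteq> elts l" unfolding b' using f(2) sub by blast
    ultimately obtain y where y: "y \<in> elts Y \<union> {vempty}" "fibre_bounded f l (elts b' - elts y)"
      using Y unfolding almost_covers_def by blast
    have hit: "\<exists>k\<in>elts omega. vapp f (pair a k) \<in> elts y" if a: "a \<in> elts b" for a
    proof -
      obtain m where m: "m \<in> elts omega" "\<forall>k\<in>elts omega. vapp f (pair a k) \<in> elts b' - elts y \<longrightarrow> k \<in> elts m"
        using y(2) a b unfolding fibre_bounded_def by blast
      \<comment> \<open>All coordinates missed by \<open>y\<close> over \<open>a\<close> lie in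
        \<open>m\<close>. As \<open>m\<close> is not in itself, coordinate \<open>m\<close> is not
        missed.\<close>
      have "vapp f (pair a m) \<in> elts b'" unfolding b' using a m(1) by simp
      then show ?thesis using m mem_irrefl[of m] by blast
    qed
    show "b = vempty \<or> (\<exists>x\<in>elts X. elts b \<subseteq> elts x)"
    proof (cases "y \<in> elts Y")
      case True
      have "elts b \<subseteq> elts (G y)" using hit b by (auto simp: G)
      then show ?thesis using True by (auto simp: X)
    next
      case False
      then have "a \<notin> elts b" for a using hit[of a] y(1) by auto
      then have "elts b = {}" by blast
      then show ?thesis by simp
    qed
  qed
  then have "ord_le (cov l aleph1 aleph1 vtwo) (vcard X)" by (rule cov_le)
  moreover have "lepoll X Y" by (rule lepoll_image[OF dG]) (simp add: X)
  ultimately show ?thesis using ord_le_trans[OF ordinal_vcard] vcard_mono by blast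
qed

lemma Lc_card_eq_cov:
  assumes "lepoll (vprod l omega) l"
  shows "Lc_card {l} = Ord (cov l aleph1 aleph1 vtwo)"
proof -
  let ?S = "{class_card Y | Y. Y \<in> QtNaamen \<and> arrow_h {l} Y \<and> cofibrant Y}"
  let ?m = "Ord (cov l aleph1 aleph1 vtwo)"
  obtain X where X: "is_cover l aleph1 aleph1 vtwo X" "cov l aleph1 aleph1 vtwo = vcard X"
    using ex_min_cover by blast
  have "class_card (elts X) = ?m" by (simp add: class_card_def X(2))
  then have mem: "?m \<in> ?S" using cover_in_derived_set[OF X(1)] by (metis (mono_tags, lifting) mem_Collect_eq)
  have le: "on_top_le ?m a" if "a \<in> ?S" for a
  proof -
    obtain Y where Y: "a = class_card Y" "arrow_h {l} Y" "cofibrant Y" using \<open>a \<in> ?S\<close> by blast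
    show ?thesis
    proof (cases "is_set Y")
      case True
      then obtain y where y: "Y = elts y" unfolding is_set_def by blast
      then show ?thesis using cov_le_derived_set[OF assms] Y by (simp add: class_card_def)
    next
      case False
      then show ?thesis by (simp add: Y(1) class_card_def)
    qed
  qed
  have "on_top_min ?S = ?m" unfolding on_top_min_def
  proof (rule the_equality)
    show "?m \<in> ?S \<and> (\<forall>a\<in>?S. on_top_le ?m a)" using mem le by blast
    fix m assume m: "m \<in> ?S \<and> (\<forall>a\<in>?S. on_top_le m a)"
    then have "on_top_le m ?m" "on_top_le ?m m" using mem le by blast+
    then show "m = ?m" by (cases m) (auto dest: ord_le_antisym)
  qed
  then show ?thesis by (simp add: Lc_card_def)
qed

end

(* A nonzero natural number n has L_c card({n}) = 0, because {} --(w)--> {n}, but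
   cov(n, aleph1, aleph1, 2) = 1; "cardinal" is read so as to exclude exactly these cases. *)
theorem theorem1:
  fixes mem :: "'v \<Rightarrow> 'v \<Rightarrow> bool" and Cls :: "'v set set" and l :: 'v
  assumes "zfc_classes mem Cls"
    and "set_structure.cardinal mem l"
    and "\<not> mem l (set_structure.omega mem) \<or> l = set_structure.vempty mem"
  shows "class_structure.Lc_card mem Cls {l} =
    Ord (set_structure.cov mem l (set_structure.aleph1 mem) (set_structure.aleph1 mem)
          (set_structure.vtwo mem))"
proof -
  interpret zfc_classes mem Cls by (rule assms(1))
  have "lepoll (vprod l omega) l"
  \<comment> \<open>Zero and the infinite cardinals are exactly those whose product with
    \<open>omega\<close> embeds back into them.\<close>
  proof (cases "l = vempty")
    case True
    then show ?thesis by (intro lepoll_subset) (simp add: elts_vprod)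
  next
    case False
    then show ?thesis using assms(2,3) infinite_cardinal_times_omega by blast
  qed
  then show ?thesis by (rule Lc_card_eq_cov)
qed

end
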